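(* Suppose the random walk on $X$ induced by $\mu$ is uniquely ergodic, locally uniformly recurrent on average, and admits a Lyapunov function $V$. Let $\varphi:\mathbb{N}\to[1,\infty)$ have sub-exponential growth. Then for every $f\in C_c(X)$, $$\lim_{n\to\infty}\ \sup_{x\in X:\ V(x)\le\varphi(n)}\Big|\frac1n\sum_{k=0}^{n-1}\int_X f\,d(\mu^{*k}*\delta_x)-\int_X f\,dm_X\Big|=0.$$
   Context: Standing assumptions: $G$ is a locally compact $\sigma$-compact metrizable group acting ergodically on a locally compact $\sigma$-compact metrizable space $X$ with a $G$-invariant probability measure $m_X$; $\mu$ is a Borel probability measure on $G$; $\pi(\mu)F(x)=\int_G F(gx)\,d\mu(g)$; $\mu^{*n}*\delta_x$ is the push-forward of $\mu^{\otimes n}\otimes\delta_x$ under $(g_n,\dots,g_1,x)\mapsto g_n\cdots g_1x$. A probability measure $\nu$ is $\mu$-stationary if $\mu*\nu=\nu$; the random walk is uniquely ergodic if $m_X$ is the unique $\mu$-stationary probability measure. It is locally uniformly recurrent on average if for every compact $K$ and $\epsilon>0$ there are $n_0$ and compact $M$ with $\frac1n\sum_{k=0}^{n-1}\mu^{*k}*\delta_x(M)\ge1-\epsilon$ for all $n\ge n_0$, $x\in K$. A Lyapunov function is a proper continuous $V:X\to[0,\infty)$ with constants $\alpha<1$, $\beta\ge0$ such that $\pi(\mu)V\le\alpha V+\beta$. $\varphi$ has sub-exponential growth if $\limsup_{n\to\infty}\frac1n\log\varphi(n)=0$. *)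

theory Defs
  imports "HOL-Analysis.Analysis" "HOL-Probability.Probability"
begin

text \<open>Locally compact, sigma-compact metrizable space: a type of class metric_space
  (metrizable, the metric is chosen compatible) whose topology is locally compact and
  which is a countable union of compact sets.\<close>
definition lcsc_space :: "('a::metric_space) itself \<Rightarrow> bool" where
  "lcsc_space _ \<longleftrightarrow> locally_compact_space (euclidean :: 'a topology) \<and>
     (\<exists>K :: nat \<Rightarrow> 'a set. (\<forall>n. compact (K n)) \<and> (\<Union>n. K n) = UNIV)"

text \<open>Topological group structure on a type, given by explicit operations.\<close>
definition topological_group_ops ::
    "('g::metric_space \<Rightarrow> 'g \<Rightarrow> 'g) \<Rightarrow> ('g \<Rightarrow> 'g) \<Rightarrow> 'g \<Rightarrow> bool" where
  "topological_group_ops mul ginv e \<longleftrightarrow>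
     (\<forall>a b c. mul (mul a b) c = mul a (mul b c)) \<and>
     (\<forall>a. mul e a = a \<and> mul a e = a) \<and>
     (\<forall>a. mul (ginv a) a = e \<and> mul a (ginv a) = e) \<and>
     continuous_on UNIV (\<lambda>p. mul (fst p) (snd p)) \<and>
     continuous_on UNIV ginv"

text \<open>Continuous (left) action of the group on the space.\<close>
definition continuous_action ::
    "('g::metric_space \<Rightarrow> 'g \<Rightarrow> 'g) \<Rightarrow> 'g \<Rightarrow> ('g \<Rightarrow> 'x::metric_space \<Rightarrow> 'x) \<Rightarrow> bool" where
  "continuous_action mul e act \<longleftrightarrow>
     (\<forall>x. act e x = x) \<and> (\<forall>g h x. act (mul g h) x = act g (act h x)) \<and>
     continuous_on UNIV (\<lambda>p. act (fst p) (snd p))"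

text \<open>Borel probability measure on a topological type.\<close>
definition borel_prob :: "('a::topological_space) measure \<Rightarrow> bool" where
  "borel_prob M \<longleftrightarrow> prob_space M \<and> sets M = sets borel"

text \<open>G-invariance and ergodicity of m_X.\<close>
definition invariant_measure :: "('g \<Rightarrow> 'x::topological_space \<Rightarrow> 'x) \<Rightarrow> 'x measure \<Rightarrow> bool" where
  "invariant_measure act m \<longleftrightarrow> (\<forall>g. distr m borel (act g) = m)"

definition ergodic_action :: "('g \<Rightarrow> 'x::topological_space \<Rightarrow> 'x) \<Rightarrow> 'x measure \<Rightarrow> bool" where
  "ergodic_action act m \<longleftrightarrow>
     (\<forall>A \<in> sets borel. (\<forall>g. act g -` A = A) \<longrightarrow> emeasure m A = 0 \<or> emeasure m A = 1)"

text \<open>Convolution mu * nu: push-forward of mu \<otimes> nu under (g,y) \<mapsto> g y.\<close>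
definition conv_meas ::
    "('g \<Rightarrow> 'x::topological_space \<Rightarrow> 'x) \<Rightarrow> 'g measure \<Rightarrow> 'x measure \<Rightarrow> 'x measure" where
  "conv_meas act \<mu> \<nu> = distr (\<mu> \<Otimes>\<^sub>M \<nu>) borel (\<lambda>p. act (fst p) (snd p))"

definition stationary ::
    "('g \<Rightarrow> 'x::topological_space \<Rightarrow> 'x) \<Rightarrow> 'g measure \<Rightarrow> 'x measure \<Rightarrow> bool" where
  "stationary act \<mu> \<nu> \<longleftrightarrow> conv_meas act \<mu> \<nu> = \<nu>"

text \<open>Position after k steps: walk_pos act w k x = g_k \<cdots> g_1 x where g_{i+1} = w i.\<close>
fun walk_pos :: "('g \<Rightarrow> 'x \<Rightarrow> 'x) \<Rightarrow> (nat \<Rightarrow> 'g) \<Rightarrow> nat \<Rightarrow> 'x \<Rightarrow> 'x" where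
  "walk_pos act w 0 x = x"
| "walk_pos act w (Suc k) x = act (w k) (walk_pos act w k x)"

text \<open>mu^{*n} * delta_x: push-forward of mu^{\<otimes>n} \<otimes> delta_x under
  (g_n,...,g_1,x) \<mapsto> g_n \<cdots> g_1 x.\<close>
definition walk_dist ::
    "('g \<Rightarrow> 'x::topological_space \<Rightarrow> 'x) \<Rightarrow> 'g measure \<Rightarrow> nat \<Rightarrow> 'x \<Rightarrow> 'x measure" where
  "walk_dist act \<mu> n x = distr (PiM {..<n} (\<lambda>_. \<mu>)) borel (\<lambda>w. walk_pos act w n x)"

definition uniquely_ergodic ::
    "('g \<Rightarrow> 'x::topological_space \<Rightarrow> 'x) \<Rightarrow> 'g measure \<Rightarrow> 'x measure \<Rightarrow> bool" where
  "uniquely_ergodic act \<mu> m \<longleftrightarrow>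
     (\<forall>\<nu>. borel_prob \<nu> \<and> stationary act \<mu> \<nu> \<longrightarrow> \<nu> = m)"

definition loc_unif_recurrent_avg ::
    "('g \<Rightarrow> 'x::metric_space \<Rightarrow> 'x) \<Rightarrow> 'g measure \<Rightarrow> bool" where
  "loc_unif_recurrent_avg act \<mu> \<longleftrightarrow>
     (\<forall>K \<epsilon>. compact K \<and> \<epsilon> > 0 \<longrightarrow>
        (\<exists>n0 M. compact M \<and>
           (\<forall>n \<ge> n0. \<forall>x \<in> K.
              (1 / real n) * (\<Sum>k<n. measure (walk_dist act \<mu> k x) M) \<ge> 1 - \<epsilon>)))"

text \<open>pi(mu)F(x) = int F(g x) d mu(g), for nonnegative F (as an extended nonnegative value).\<close>
definition pi_op :: "('g \<Rightarrow> 'x \<Rightarrow> 'x) \<Rightarrow> 'g measure \<Rightarrow> ('x \<Rightarrow> real) \<Rightarrow> 'x \<Rightarrow> ennreal" where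
  "pi_op act \<mu> F x = (\<integral>\<^sup>+ g. ennreal (F (act g x)) \<partial>\<mu>)"

definition lyapunov ::
    "('g \<Rightarrow> 'x::metric_space \<Rightarrow> 'x) \<Rightarrow> 'g measure \<Rightarrow> ('x \<Rightarrow> real) \<Rightarrow> bool" where
  "lyapunov act \<mu> V \<longleftrightarrow>
     continuous_on UNIV V \<and> (\<forall>x. V x \<ge> 0) \<and>
     (\<forall>K. compact K \<longrightarrow> compact (V -` K)) \<and>
     (\<exists>\<alpha> \<beta>. \<alpha> < 1 \<and> \<beta> \<ge> 0 \<and>
        (\<forall>x. 0 \<le> \<alpha> * V x + \<beta> \<and> pi_op act \<mu> V x \<le> ennreal (\<alpha> * V x + \<beta>)))"

definition subexp_growth :: "(nat \<Rightarrow> real) \<Rightarrow> bool" where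
  "subexp_growth \<phi> \<longleftrightarrow> limsup (\<lambda>n. ereal (ln (\<phi> n) / real n)) = 0"

text \<open>C_c(X): continuous real functions with compact support.\<close>
definition Cc :: "('x::metric_space \<Rightarrow> real) set" where
  "Cc = {f. continuous_on UNIV f \<and> compact (closure {x. f x \<noteq> 0})}"

end

theory Submission
  imports Defs
begin

text \<open>The drift inequality gives \<open>\<mu>\<^sup>*\<^sup>k * \<delta>\<^sub>x (V) \<le> \<alpha>\<^sup>k V x + \<beta> / (1 - \<alpha>)\<close>, so the Cesaro averages started in a
  compact set \<open>V \<le> R\<close> are tight. Every weak limit of them is stationary by the Feller property, hence
  equal to \<open>m\<close>; this makes the convergence uniform on \<open>V \<le> R\<close>. If only \<open>V x \<le> \<phi> n\<close> is known, run the
  walk for \<open>n div D\<close> steps first: since \<open>\<phi>\<close> grows subexponentially, \<open>V\<close> then has bounded expectation, so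
  by Markov's inequality the walk sits in \<open>V \<le> R\<close> up to small probability, and the discarded steps
  weigh at most \<open>1 / D\<close>.\<close>

section \<open>Coding by the real line\<close>

text \<open>The existence of weak limits is taken from the real line, where distribution functions
  give it. The obstacle is that X need not embed continuously into the line, so the coding
  \<open>s\<close> is only Borel. It is built to keep just what is needed. Bounded distance from
  \<open>V\<close> carries tightness over. Digits 0 and 1 in base 4 leave gaps, unlike base 2, where
  0.0111... and 0.1000... coincide; hence close codes agree in their first digits, that is, in
  membership in the first basic sets. A limit law may charge points that are limits of codes without
  being codes, so decoding has to be continuous on the closure of the range; this is what brings the
  limit back to X as a measure. In the final estimate a fixed fraction of the n steps is spent on
  returning: \<open>\<alpha> ^ (n div D)\<close> decays exponentially in n for each fixed
  \<open>D\<close> and so absorbs \<open>\<phi> n\<close>. Hence \<open>D\<close> can be chosen from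
  the error alone, before n grows.\<close>

lemma lcsc_space_countable_basis:
  assumes "lcsc_space TYPE('a::metric_space)"
  shows "\<exists>U :: nat \<Rightarrow> 'a set. topological_basis (range U)"
proof -
  obtain K :: "nat \<Rightarrow> 'a set" where K: "\<And>n. compact (K n)" "(\<Union>n. K n) = UNIV"
    using assms unfolding lcsc_space_def by blast
  \<comment> \<open>Finite nets at all scales in each of the countably many compact pieces supply
    the countably many balls of the basis.\<close>
  have "\<exists>D. finite D \<and> K n \<subseteq> (\<Union>x\<in>D. ball x (1 / real (Suc l)))" for n l
  proof -
    have cover: "K n \<subseteq> (\<Union>x\<in>K n. ball x (1 / real (Suc l)))" by auto
    obtain D where "D \<subseteq> K n" "finite D" "K n \<subseteq> (\<Union>x\<in>D. ball x (1 / real (Suc l)))"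
      by (rule compactE_image[OF K(1) _ cover]) auto
    then show ?thesis by blast
  qed
  then obtain D where D: "\<And>n l. finite (D n l)"
    "\<And>n l. K n \<subseteq> (\<Union>x\<in>D n l. ball x (1 / real (Suc l)))"
    by metis
  define B where "B = (\<Union>n l. (\<lambda>x. ball x (1 / real (Suc l))) ` D n l)"
  have "countable B"
    unfolding B_def using countable_finite[OF D(1)] by simp
  have fine: "\<exists>b\<in>B. x \<in> b \<and> b \<subseteq> O'" if O': "open O'" "x \<in> O'" for x O'
  proof -
    obtain r where r: "r > 0" "ball x r \<subseteq> O'"
      using O' unfolding open_contains_ball by blast
    obtain l where l: "1 / real (Suc l) < r / 2"
      using r(1) nat_approx_posE[of "r/2"] by auto
    obtain n where "x \<in> K n" using K(2) by blast
    then obtain z where z: "z \<in> D n l" "x \<in> ball z (1 / real (Suc l))" using D(2)[of n l] by blast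
    have "ball z (1 / real (Suc l)) \<subseteq> ball x r"
    proof
      fix y assume "y \<in> ball z (1 / real (Suc l))"
      then show "y \<in> ball x r"
        using z(2) l dist_triangle[of x y z] by (simp add: dist_commute)
    qed
    then show ?thesis using z r unfolding B_def by blast
  qed
  \<comment> \<open>Nonemptiness is what lets \<open>from_nat_into\<close> enumerate
    \<open>B\<close> as a range; a type always has the point \<open>undefined\<close>.\<close>
  have "B \<noteq> {}" using fine[of UNIV undefined] by auto
  have "topological_basis B"
    by (rule topological_basisI) (use fine in \<open>auto simp: B_def\<close>)
  then have "topological_basis (range (from_nat_into B))"
    using \<open>countable B\<close> \<open>B \<noteq> {}\<close> by simp
  then show ?thesis by blast
qed

text \<open>Integration over product measures needs measurability for
  \<open>borel \<Otimes>\<^sub>M borel\<close>, which in general may be smaller than the Borel sets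
  of the product. Countable bases close the gap: an open preimage is a countable union of basic
  rectangles.\<close>

lemma continuous_on_prod_measurable:
  fixes f :: "'a::topological_space \<times> 'b::topological_space \<Rightarrow> 'c::topological_space"
    and U :: "nat \<Rightarrow> 'a set" and W :: "nat \<Rightarrow> 'b set"
  assumes U: "topological_basis (range U)" and W: "topological_basis (range W)"
    and f: "continuous_on UNIV f"
  shows "f \<in> borel \<Otimes>\<^sub>M borel \<rightarrow>\<^sub>M borel"
proof (rule borel_measurableI)
  fix S :: "'c set" assume "open S"
  then have op: "open (f -` S)" using f by (simp add: open_vimage)
  define I where "I = {p. U (fst p) \<times> W (snd p) \<subseteq> f -` S}"
  have 1: "p \<in> (\<Union>p\<in>I. U (fst p) \<times> W (snd p))" if p: "p \<in> f -` S" for p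
  proof -
    obtain A B where AB: "open A" "open B" "p \<in> A \<times> B" "A \<times> B \<subseteq> f -` S"
      by (rule open_prod_elim[OF op p])
    obtain i where i: "fst p \<in> U i" "U i \<subseteq> A" using AB by (auto elim: topological_basisE[OF U, of A "fst p"])
    obtain j where j: "snd p \<in> W j" "W j \<subseteq> B" using AB by (auto elim: topological_basisE[OF W, of B "snd p"])
    have "U i \<times> W j \<subseteq> f -` S" using i(2) j(2) AB(4) by (meson Sigma_mono subset_trans)
    then have "(i, j) \<in> I" unfolding I_def by simp
    moreover have "p \<in> U (fst (i, j)) \<times> W (snd (i, j))" using i j by (simp add: mem_Times_iff)
    ultimately show ?thesis by (rule UN_I)
  qed
  have 2: "(\<Union>p\<in>I. U (fst p) \<times> W (snd p)) \<subseteq> f -` S"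
    unfolding I_def by (rule UN_least) simp
  have "f -` S = (\<Union>p\<in>I. U (fst p) \<times> W (snd p))"
    by (rule equalityI[OF subsetI[OF 1] 2])
  also have "\<dots> \<in> sets (borel \<Otimes>\<^sub>M borel)"
    using topological_basis_open[OF U] topological_basis_open[OF W]
    by (intro sets.countable_UN'' pair_measureI borel_open) auto
  finally show "f -` S \<inter> space (borel \<Otimes>\<^sub>M borel) \<in> sets (borel \<Otimes>\<^sub>M borel)"
    by (simp add: space_pair_measure)
qed

text \<open>The tail of the expansion after position \<open>k\<close> is at most a third of \<open>4 ^ - k\<close>, so it cannot
  compensate a nonzero integer digit.\<close>

lemma base4_digits_zero:
  fixes d :: "nat \<Rightarrow> real"
  assumes int: "\<And>i. d i \<in> \<int>" and le: "\<And>i. i \<ge> 1 \<Longrightarrow> \<bar>d i\<bar> \<le> 1"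
    and small: "\<bar>\<Sum>i. d i / 4 ^ i\<bar> < 2 / 3 / 4 ^ N" and "k \<le> N"
  shows "d k = 0"
  using \<open>k \<le> N\<close>
proof (induction k rule: less_induct)
  case (less k)
  have geo: "summable (\<lambda>i. (1/4::real) ^ i)" "suminf ((^) (1/4::real)) = 4 / 3"
    by (simp_all add: summable_geometric suminf_geometric)
  have "norm (d (Suc i) / 4 ^ Suc i) \<le> (1/4) ^ i" for i
    using le[of "Suc i"] by (simp add: power_one_over divide_simps)
  then have "summable (\<lambda>i. d (Suc i) / 4 ^ Suc i)"
    by (intro summable_comparison_test'[OF geo(1), of 0])
  then have sm: "summable (\<lambda>i. d i / 4 ^ i)" by (subst (asm) summable_Suc_iff)
  have tail_sm: "summable (\<lambda>i. d (i + Suc k) / 4 ^ (i + Suc k))"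
    using sm by (subst summable_iff_shift)
  have tail_le: "norm (d (i + Suc k) / 4 ^ (i + Suc k)) \<le> (1/4) ^ Suc k * (1/4) ^ i" for i
    using le[of "i + Suc k"] by (simp add: power_add power_one_over divide_simps)
  have "\<bar>\<Sum>i. d (i + Suc k) / 4 ^ (i + Suc k)\<bar> \<le> (\<Sum>i. (1/4) ^ Suc k * (1/4) ^ i)"
    using norm_suminf_le[OF tail_le summable_mult[OF geo(1)]] unfolding real_norm_def .
  also have "\<dots> = (1/4) ^ Suc k * (4 / 3)"
    by (simp only: suminf_mult[OF geo(1)] geo(2))
  also have "\<dots> = 1 / 3 / 4 ^ k"
    by (simp add: power_one_over)
  finally have tail: "\<bar>\<Sum>i. d (i + Suc k) / 4 ^ (i + Suc k)\<bar> \<le> 1 / 3 / 4 ^ k" .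
  have "(\<Sum>i. d i / 4 ^ i) = (\<Sum>i. d (i + Suc k) / 4 ^ (i + Suc k)) + (\<Sum>i<Suc k. d i / 4 ^ i)"
    by (rule suminf_split_initial_segment[OF sm])
  also have "(\<Sum>i<Suc k. d i / 4 ^ i) = d k / 4 ^ k"
    using less by simp
  \<comment> \<open>By the induction hypothesis only digit \<open>k\<close> is left in the initial
    segment. The allowances 2/3 and 1/3 add up to 1, so the integer \<open>d k\<close> has absolute
    value below 1.\<close>
  finally have "\<bar>d k / 4 ^ k\<bar> < 2 / 3 / 4 ^ N + 1 / 3 / 4 ^ k"
    using small tail by linarith
  also have "2 / 3 / 4 ^ N \<le> 2 / 3 / (4::real) ^ k"
    using less.prems by (intro divide_left_mono) (auto intro: power_increasing)
  finally have "\<bar>d k\<bar> / 4 ^ k < 1 / 4 ^ k" by simp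
  then have "\<bar>d k\<bar> < 1" by (simp add: divide_simps)
  then show "d k = 0" using int[of k] by (metis Ints_nonzero_abs_less1)
qed

text \<open>The Borel map \<open>s\<close> records the integer part of the exhaustion function \<open>V\<close> and, in the
  fractional part, membership in the members of a countable basis. It is discontinuous, but its
  inverse extends continuously to the closure of the range, by compactness of the sublevel sets.\<close>

lemma real_coding:
  fixes U :: "nat \<Rightarrow> 'a::metric_space set" and V :: "'a \<Rightarrow> real"
  assumes U: "topological_basis (range U)"
    and V: "continuous_on UNIV V" "\<And>R. compact {x. V x \<le> R}"
  shows "\<exists>(s :: 'a \<Rightarrow> real) c. s \<in> borel_measurable borel \<and> (\<forall>x. \<bar>s x - V x\<bar> \<le> 1) \<and>
    continuous_on (closure (range s)) c \<and> (\<forall>x. c (s x) = x)"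
proof -
  \<comment> \<open>Position 0 holds an arbitrary integer, so membership in \<open>U N\<close> is
    stored at position \<open>Suc N\<close>. All digits are integers, as the digit comparison
    requires.\<close>
  define a where "a x i = (if i = 0 then of_int \<lfloor>V x\<rfloor> else indicat_real (U (i - 1)) x)" for x i
  have a_int: "a x i \<in> \<int>" for x i
    by (simp add: a_def indicator_def)
  have a_le: "0 \<le> a x (Suc i)" "a x (Suc i) \<le> 1" for x i
    by (simp_all add: a_def indicator_def)
  have geo: "summable (\<lambda>i. (1/4::real) ^ Suc i)" "(\<Sum>i. (1/4::real) ^ Suc i) = 1 / 3"
    using suminf_mult[of "\<lambda>i. (1/4::real) ^ i" "1/4"] suminf_geometric[of "1/4::real"]
    by (simp_all add: summable_geometric)
  have bd: "norm (a x (Suc i) / 4 ^ Suc i) \<le> (1/4) ^ Suc i" for x i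
    using a_le[of x i] by (simp add: power_one_over divide_simps)
  have sm': "summable (\<lambda>i. a x (Suc i) / 4 ^ Suc i)" for x
    by (rule summable_comparison_test'[OF geo(1) bd])
  then have sm: "summable (\<lambda>i. a x i / 4 ^ i)" for x
    by (subst (asm) summable_Suc_iff)
  define s where "s x = (\<Sum>i. a x i / 4 ^ i)" for x
  have s_eq: "s x = of_int \<lfloor>V x\<rfloor> + (\<Sum>i. a x (Suc i) / 4 ^ Suc i)" for x
    using suminf_split_head[OF sm[of x]] unfolding s_def by (simp add: a_def)
  have tail: "0 \<le> (\<Sum>i. a x (Suc i) / 4 ^ Suc i)" "(\<Sum>i. a x (Suc i) / 4 ^ Suc i) \<le> 1 / 3" for x
  proof -
    show "0 \<le> (\<Sum>i. a x (Suc i) / 4 ^ Suc i)"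
      by (intro suminf_nonneg sm' divide_nonneg_nonneg a_le) simp
    have "norm (\<Sum>i. a x (Suc i) / 4 ^ Suc i) \<le> (\<Sum>i. (1/4) ^ Suc i)"
      by (rule norm_suminf_le[OF bd geo(1)])
    then show "(\<Sum>i. a x (Suc i) / 4 ^ Suc i) \<le> 1 / 3"
      unfolding geo(2) real_norm_def by linarith
  qed
  have s_V: "\<bar>s x - V x\<bar> \<le> 1" for x
    using tail[of x] floor_correct[of "V x"] unfolding s_eq by linarith
  have [measurable]: "V \<in> borel_measurable borel"
    by (rule borel_measurable_continuous_onI[OF V(1)])
  have [measurable]: "U i \<in> sets borel" for i
    by (rule borel_open) (simp add: topological_basis_open[OF U])
  have [measurable]: "(\<lambda>x. a x i) \<in> borel_measurable borel" for i
    unfolding a_def by (cases "i = 0") auto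
  have s_meas: "s \<in> borel_measurable borel"
    unfolding s_def by measurable
  have digits: "x \<in> U N \<longleftrightarrow> y \<in> U N" if close: "\<bar>s x - s y\<bar> < 2 / 3 / 4 ^ Suc N" for x y N
  proof -
    have "s x - s y = (\<Sum>i. (a x i - a y i) / 4 ^ i)"
      unfolding s_def using suminf_diff[OF sm[of x] sm[of y]] by (simp add: diff_divide_distrib)
    moreover have "\<bar>a x i - a y i\<bar> \<le> 1" if "i \<ge> 1" for i
      using a_le[of x "i - 1"] a_le[of y "i - 1"] that by auto
    ultimately have "a x (Suc N) - a y (Suc N) = 0"
      using close base4_digits_zero[of "\<lambda>i. a x i - a y i" "Suc N" "Suc N"] a_int by auto
    then show ?thesis by (simp add: a_def indicator_def of_bool_eq_iff)
  qed
  \<comment> \<open>The decoded point is a limit of points whose codes tend to \<open>t\<close>. One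
    such point in \<open>U N\<close> with code near \<open>t\<close> is enough: all points with code
    near \<open>t\<close> share its digit for \<open>U N\<close>.\<close>
  have lim: "\<exists>x. \<forall>O'. open O' \<and> x \<in> O' \<longrightarrow> (\<exists>\<delta>>0. \<forall>y. \<bar>s y - t\<bar> < \<delta> \<longrightarrow> y \<in> O')"
    if t: "t \<in> closure (range s)" for t
  proof -
    obtain Y where Y: "\<forall>n. Y n \<in> range s" "Y \<longlonglongrightarrow> t"
      using t by (auto simp: closure_sequential)
    have "\<forall>n. \<exists>x. Y n = s x" using Y(1) by (simp add: image_iff)
    then obtain X where X: "\<And>n. Y n = s (X n)" using choice by metis
    obtain n0 where n0: "\<And>n. n \<ge> n0 \<Longrightarrow> \<bar>Y n - t\<bar> < 1"
      using LIMSEQ_D[OF Y(2), of 1] by auto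
    \<comment> \<open>The 2 is 1 for the distance of the code from \<open>t\<close> plus 1 for the
      distance of \<open>s\<close> from \<open>V\<close>.\<close>
    have inK: "X (n + n0) \<in> {x. V x \<le> t + 2}" for n
      using n0[of "n + n0"] s_V[of "X (n + n0)"] unfolding X by simp
    obtain x r where r: "strict_mono r" "((\<lambda>n. X (n + n0)) \<circ> r) \<longlonglongrightarrow> x"
      by (rule seq_compactE[OF compact_imp_seq_compact[OF V(2)] allI[OF inK]])
    have Yr: "(\<lambda>j. Y (r j + n0)) \<longlonglongrightarrow> t"
      using LIMSEQ_subseq_LIMSEQ[OF LIMSEQ_ignore_initial_segment[OF Y(2), of n0] r(1)]
      by (simp add: comp_def)
    have "\<exists>\<delta>>0. \<forall>y. \<bar>s y - t\<bar> < \<delta> \<longrightarrow> y \<in> O'" if O': "open O'" "x \<in> O'" for O'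
    proof -
      obtain N where N: "x \<in> U N" "U N \<subseteq> O'" by (rule topological_basisE[OF U O']) blast
      \<comment> \<open>Half of the threshold in \<open>digits\<close>, because two codes are each
        compared with \<open>t\<close>.\<close>
      define \<delta> :: real where "\<delta> = 1 / 3 / 4 ^ Suc N"
      have "\<delta> > 0" by (simp add: \<delta>_def)
      have "eventually (\<lambda>j. X (r j + n0) \<in> U N) sequentially"
        using topological_tendstoD[OF r(2) _ N(1)] topological_basis_open[OF U] by (simp add: comp_def)
      moreover have "eventually (\<lambda>j. \<bar>Y (r j + n0) - t\<bar> < \<delta>) sequentially"
        using tendstoD[OF Yr \<open>\<delta> > 0\<close>] by (simp add: dist_real_def)
      ultimately obtain j where j: "X (r j + n0) \<in> U N" "\<bar>Y (r j + n0) - t\<bar> < \<delta>"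
        using eventually_happens'[OF sequentially_bot eventually_conj] by blast
      have "y \<in> O'" if y: "\<bar>s y - t\<bar> < \<delta>" for y
      proof -
        have "\<bar>s y - s (X (r j + n0))\<bar> < \<delta> + \<delta>"
          using y j(2) unfolding X by linarith
        then have "y \<in> U N" using digits[of y "X (r j + n0)" N] j(1) by (simp add: \<delta>_def)
        then show ?thesis using N(2) by blast
      qed
      then show ?thesis using \<open>\<delta> > 0\<close> by blast
    qed
    then show ?thesis by blast
  qed
  define c where
    "c t = (SOME x. \<forall>O'. open O' \<and> x \<in> O' \<longrightarrow> (\<exists>\<delta>>0. \<forall>y. \<bar>s y - t\<bar> < \<delta> \<longrightarrow> y \<in> O'))" for t
  have c: "\<exists>\<delta>>0. \<forall>y. \<bar>s y - t\<bar> < \<delta> \<longrightarrow> dist y (c t) < \<epsilon>"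
    if t: "t \<in> closure (range s)" and "\<epsilon> > 0" for t \<epsilon>
    using someI_ex[OF lim[OF t], THEN spec, of "ball (c t) \<epsilon>"] \<open>\<epsilon> > 0\<close>
    unfolding c_def[symmetric] by (simp add: dist_commute)
  \<comment> \<open>The point \<open>x\<close> itself has code at distance 0 from
    \<open>s x\<close>, hence lies in every ball around \<open>c (s x)\<close>.\<close>
  have cs: "c (s x) = x" for x
  proof (rule ccontr)
    assume "c (s x) \<noteq> x"
    then have "dist x (c (s x)) > 0" by simp
    from c[OF _ this] show False
      using closure_subset[of "range s"] by force
  qed
  have "continuous_on (closure (range s)) c"
    unfolding continuous_on_iff
  proof (intro ballI allI impI)
    fix t :: real and \<epsilon> :: real assume t: "t \<in> closure (range s)" and "\<epsilon> > 0"
    obtain \<delta> where \<delta>: "\<delta> > 0" "\<And>y. \<bar>s y - t\<bar> < \<delta> \<Longrightarrow> dist y (c t) < \<epsilon> / 2"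
      using c[OF t, of "\<epsilon> / 2"] \<open>\<epsilon> > 0\<close> by auto
    have "dist (c t') (c t) < \<epsilon>" if t': "t' \<in> closure (range s)" "dist t' t < \<delta>" for t'
    proof -
      obtain \<delta>' where \<delta>': "\<delta>' > 0" "\<And>y. \<bar>s y - t'\<bar> < \<delta>' \<Longrightarrow> dist y (c t') < \<epsilon> / 2"
        using c[OF t'(1), of "\<epsilon> / 2"] \<open>\<epsilon> > 0\<close> by auto
      \<comment> \<open>A point \<open>y\<close> of X coded close enough to \<open>t'\<close> is
        still within \<open>\<delta>\<close> of \<open>t\<close>; being near both decoded points, it
        bounds their distance.\<close>
      have "min \<delta>' (\<delta> - dist t' t) > 0" using t'(2) \<delta>'(1) by simp
      then obtain y where y: "dist (s y) t' < min \<delta>' (\<delta> - dist t' t)"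
        using t'(1) unfolding closure_approachable by fast
      have "dist y (c t') < \<epsilon> / 2" using y by (intro \<delta>') (simp add: dist_real_def)
      moreover have "dist y (c t) < \<epsilon> / 2"
        using y by (intro \<delta>) (simp add: dist_real_def, linarith)
      ultimately show ?thesis using dist_triangle3[of "c t'" "c t" y] by linarith
    qed
    then show "\<exists>\<delta>>0. \<forall>t'\<in>closure (range s). dist t' t < \<delta> \<longrightarrow> dist (c t') (c t) < \<epsilon>"
      using \<delta>(1) by blast
  qed
  then show ?thesis using s_meas s_V cs by blast
qed

section \<open>Tight sequences of probability measures\<close>

lemma borel_prob_D:
  assumes "borel_prob M"
  shows "prob_space M" "sets M = sets borel" "space M = UNIV"
  using assms sets_eq_imp_space_eq[of M borel] unfolding borel_prob_def by auto

lemma borel_prob_integrable_bounded: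
  fixes F :: "'a::topological_space \<Rightarrow> real"
  assumes "borel_prob M" "F \<in> borel_measurable borel" "\<And>x. \<bar>F x\<bar> \<le> B"
  shows "integrable M F"
proof -
  interpret prob_space M using assms(1) by (rule borel_prob_D)
  show ?thesis
    using assms by (intro integrable_const_bound[of _ B]) (auto simp: borel_prob_def cong: measurable_cong_sets)
qed

lemma borel_prob_abs_integral_le:
  fixes F :: "'a::topological_space \<Rightarrow> real"
  assumes "borel_prob M" "F \<in> borel_measurable borel" "\<And>x. \<bar>F x\<bar> \<le> B"
  shows "\<bar>\<integral>x. F x \<partial>M\<bar> \<le> B"
proof -
  interpret prob_space M using assms(1) by (rule borel_prob_D)
  have int: "integrable M F" by (rule borel_prob_integrable_bounded[OF assms])
  have "\<bar>\<integral>x. F x \<partial>M\<bar> \<le> (\<integral>x. \<bar>F x\<bar> \<partial>M)" by (rule integral_abs_bound)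
  also have "\<dots> \<le> B"
    using int assms(3) by (intro integral_le_const) auto
  finally show ?thesis .
qed

text \<open>Closed sets form an intersection-stable generator, and the indicator of a closed set is
  the pointwise limit of the continuous cut-offs
  \<open>max 0 (1 - real k * infdist x X)\<close>.\<close>

lemma borel_prob_eqI:
  fixes M N :: "'a::metric_space measure"
  assumes M: "borel_prob M" and N: "borel_prob N"
    and eq: "\<And>F. continuous_on UNIV F \<Longrightarrow> (\<And>x. \<bar>F x\<bar> \<le> 1) \<Longrightarrow> (\<integral>x. F x \<partial>M) = (\<integral>x. F x \<partial>N :: real)"
  shows "M = N"
proof (rule measure_eqI_generator_eq[where E="{C. closed C}" and \<Omega>=UNIV and A="\<lambda>_. UNIV"])
  interpret M: prob_space M using M by (rule borel_prob_D)
  interpret N: prob_space N using N by (rule borel_prob_D)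
  note M' = borel_prob_D(2,3)[OF M] and N' = borel_prob_D(2,3)[OF N]
  show "Int_stable {C :: 'a set. closed C}" by (auto simp: Int_stable_def)
  have *: "sets (borel :: 'a measure) = sigma_sets UNIV {C. closed C}"
    unfolding borel_eq_closed by (simp add: sets_measure_of)
  show "sets M = sigma_sets UNIV {C. closed C}" "sets N = sigma_sets UNIV {C. closed C}"
    using M' N' * by simp_all
  show "emeasure M X = emeasure N X" if "X \<in> {C. closed C}" for X
  \<comment> \<open>\<open>infdist x {}\<close> is 0 by convention, so the cut-offs would tend to 1
    instead of 0 on the empty set.\<close>
  proof (cases "X = {}")
    case False
    have "closed X" using that by simp
    define F where "F k x = max 0 (1 - real k * infdist x X)" for k x
    have cont: "continuous_on UNIV (F k)" for k
      unfolding F_def by (intro continuous_intros)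
    have bd: "\<bar>F k x\<bar> \<le> 1" for k x
      unfolding F_def using infdist_nonneg[of x X] by (auto simp: max_def)
    have [measurable]: "F k \<in> borel_measurable borel" for k
      by (rule borel_measurable_continuous_onI[OF cont])
    have [measurable]: "X \<in> sets borel" using \<open>closed X\<close> by simp
    have lim: "(\<lambda>k. F k x) \<longlonglongrightarrow> indicat_real X x" for x
    proof (cases "x \<in> X")
      case True
      then show ?thesis unfolding F_def by simp
    next
      case x: False
      then have pos: "infdist x X > 0"
        using \<open>closed X\<close> False infdist_pos_not_in_closed by metis
      obtain k0 :: nat where "1 < real k0 * infdist x X"
        using reals_Archimedean3[OF pos] by blast
      moreover have "real k0 * infdist x X \<le> real k * infdist x X" if "k \<ge> k0" for k
        using that pos by (intro mult_right_mono) auto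
      ultimately have "F k x = 0" if "k \<ge> k0" for k
        using that unfolding F_def by (fastforce simp: max_def)
      then show ?thesis using x
        by (intro tendsto_eventually) (auto simp: eventually_sequentially)
    qed
    have conv: "(\<lambda>k. \<integral>x. F k x \<partial>L) \<longlonglongrightarrow> measure L X" if L: "borel_prob L" for L
    proof -
      interpret L: prob_space L using L by (rule borel_prob_D)
      note [measurable_cong] = borel_prob_D(2)[OF L]
      have "(\<lambda>k. \<integral>x. F k x \<partial>L) \<longlonglongrightarrow> (\<integral>x. indicat_real X x \<partial>L)"
        using lim bd by (intro integral_dominated_convergence[where w="\<lambda>_. 1"]) auto
      then show ?thesis using borel_prob_D(2,3)[OF L] by simp
    qed
    have "measure M X = measure N X"
      using LIMSEQ_unique[OF conv[OF M]] conv[OF N] eq[OF cont bd] by simp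
    then show ?thesis by (simp add: M.emeasure_eq_measure N.emeasure_eq_measure)
  qed simp
qed (use borel_prob_D[OF M] prob_space.emeasure_space_1[of M] in auto)

text \<open>A form of Prokhorov's theorem: after transport by the coding map, Helly selection on the
  real line applies; Tietze's theorem turns \<open>F \<circ> c\<close> into a test function on the line.\<close>

lemma tight_sequence_convergent_subsequence:
  fixes U :: "nat \<Rightarrow> 'a::metric_space set" and V :: "'a \<Rightarrow> real" and \<nu> :: "nat \<Rightarrow> 'a measure"
  assumes U: "topological_basis (range U)"
    and V: "continuous_on UNIV V" "\<And>x. V x \<ge> 0" "\<And>R. compact {x. V x \<le> R}"
    and \<nu>: "\<And>n. borel_prob (\<nu> n)"
    and tight: "\<And>\<epsilon>. \<epsilon> > 0 \<Longrightarrow> \<exists>R. \<forall>n. measure (\<nu> n) {x. V x \<le> R} > 1 - \<epsilon>"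
  shows "\<exists>r \<nu>'. strict_mono (r :: nat \<Rightarrow> nat) \<and> borel_prob \<nu>' \<and>
    (\<forall>F B. continuous_on UNIV F \<longrightarrow> (\<forall>x. \<bar>F x :: real\<bar> \<le> B) \<longrightarrow>
       (\<lambda>j. \<integral>x. F x \<partial>\<nu> (r j)) \<longlonglongrightarrow> (\<integral>x. F x \<partial>\<nu>'))"
proof -
  obtain s c where s [measurable]: "s \<in> borel_measurable borel" and sV: "\<And>x. \<bar>s x - V x\<bar> \<le> 1"
    and c: "continuous_on (closure (range s)) c" and cs: "\<And>x. c (s x) = x"
    using real_coding[OF U V(1,3)] by blast
  define S where "S = closure (range s)"
  have S: "closed S" "S \<noteq> {}" "\<And>x. s x \<in> S"
    unfolding S_def using closure_subset[of "range s"] by auto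
  have s_\<nu> [measurable]: "s \<in> borel_measurable (\<nu> n)" for n
    using s borel_prob_D(2)[OF \<nu>[of n]] by (simp cong: measurable_cong_sets)
  define \<rho> where "\<rho> n = distr (\<nu> n) borel s" for n
  have \<rho>: "real_distribution (\<rho> n)" for n
    unfolding \<rho>_def by (rule prob_space.real_distribution_distr[OF borel_prob_D(1)[OF \<nu>] s_\<nu>])
  have int_\<rho>: "(\<integral>t. G t \<partial>\<rho> n) = (\<integral>x. G (s x) \<partial>\<nu> n)" if "G \<in> borel_measurable borel" for G :: "real \<Rightarrow> real" and n
    unfolding \<rho>_def by (rule integral_distr[OF s_\<nu> that])
  have "tight \<rho>"
    unfolding tight_def
  proof (intro conjI allI impI \<rho>)
    fix \<epsilon> :: real assume "\<epsilon> > 0"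
    then obtain R where R: "\<And>n. measure (\<nu> n) {x. V x \<le> R} > 1 - \<epsilon>" using tight by blast
    \<comment> \<open>On \<open>V x \<le> R\<close> the code lies between -1 and
      \<open>R + 1\<close>; -2 allows for the open left end, and \<open>max 0 R\<close> keeps the
      interval nonempty.\<close>
    have "measure (\<rho> n) {-2<..max 0 R + 1} > 1 - \<epsilon>" for n
    proof -
      interpret prob_space "\<nu> n" by (rule borel_prob_D(1)[OF \<nu>])
      have "measure (\<nu> n) {x. V x \<le> R} \<le> measure (\<nu> n) (s -` {-2<..max 0 R + 1} \<inter> space (\<nu> n))"
      proof (rule finite_measure_mono)
        show "{x. V x \<le> R} \<subseteq> s -` {-2<..max 0 R + 1} \<inter> space (\<nu> n)"
        proof
          fix x assume "x \<in> {x. V x \<le> R}"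
          then show "x \<in> s -` {-2<..max 0 R + 1} \<inter> space (\<nu> n)"
            using sV[of x] V(2)[of x] borel_prob_D(3)[OF \<nu>[of n]] by auto
        qed
      qed measurable
      also have "\<dots> = measure (\<rho> n) {-2<..max 0 R + 1}"
        unfolding \<rho>_def by (simp add: measure_distr)
      finally show ?thesis using R[of n] by linarith
    qed
    then show "\<exists>a b. a < b \<and> (\<forall>n. measure (\<rho> n) {a<..b} > 1 - \<epsilon>)"
      by (intro exI[of _ "-2"] exI[of _ "max 0 R + 1"]) auto
  qed
  then obtain r \<eta> where r: "strict_mono r" and \<eta>: "real_distribution \<eta>"
    and conv: "weak_conv_m (\<rho> \<circ> id \<circ> r) \<eta>"
    using tight_imp_convergent_subsubsequence[OF \<open>tight \<rho>\<close> strict_mono_id] by blast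
  interpret \<eta>: real_distribution \<eta> by (rule \<eta>)
  have lim: "(\<lambda>j. \<integral>x. G (s x) \<partial>\<nu> (r j)) \<longlonglongrightarrow> (\<integral>t. G t \<partial>\<eta>)"
    if G: "continuous_on UNIV G" "\<And>t. \<bar>G t\<bar> \<le> B" for G :: "real \<Rightarrow> real" and B
  proof -
    have "(\<lambda>j. integral\<^sup>L ((\<rho> \<circ> id \<circ> r) j) G) \<longlonglongrightarrow> integral\<^sup>L \<eta> G"
      using weak_conv_imp_integral_bdd_continuous_conv[of "\<rho> \<circ> id \<circ> r" \<eta> G B] conv \<eta> \<rho> G
      by (simp add: continuous_on_eq_continuous_at)
    then show ?thesis
      by (simp add: int_\<rho>[OF borel_measurable_continuous_onI[OF G(1)]])
  qed
  \<comment> \<open>The bounded continuous function \<open>min 1 (infdist t S)\<close> vanishes on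
    all codes, so its integral against the limit law is 0, and it is positive off the closed set
    \<open>S\<close>.\<close>
  have "AE t in \<eta>. t \<in> S"
  proof -
    define h where "h t = min 1 (infdist t S)" for t
    have h: "continuous_on UNIV h" "\<And>t. \<bar>h t\<bar> \<le> 1" "\<And>t. h t \<ge> 0"
      unfolding h_def using infdist_nonneg[of _ S] by (auto intro!: continuous_intros)
    have [measurable]: "h \<in> borel_measurable borel"
      by (rule borel_measurable_continuous_onI[OF h(1)])
    have "h (s x) = 0" for x
      unfolding h_def using S(3)[of x] by simp
    then have "(\<lambda>j::nat. 0) \<longlonglongrightarrow> (\<integral>t. h t \<partial>\<eta>)"
      using lim[OF h(1,2)] by simp
    then have "(\<integral>t. h t \<partial>\<eta>) = 0" by (simp add: LIMSEQ_const_iff)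
    moreover have "integrable \<eta> h"
      by (rule \<eta>.integrable_const_bound[of _ 1]) (use h in auto)
    ultimately have "AE t in \<eta>. h t = 0"
      using h(3) by (subst (asm) integral_nonneg_eq_0_iff_AE) auto
    moreover have "t \<in> S" if "h t = 0" for t
    proof -
      have "infdist t S = 0" using that unfolding h_def by (simp add: min_def split: if_splits)
      then show ?thesis using S(1,2) in_closed_iff_infdist_zero by blast
    qed
    ultimately show ?thesis by (auto elim: AE_mp)
  qed
  \<comment> \<open>The value off \<open>S\<close> is immaterial to \<open>\<eta>\<close>; a
    constant there gives a Borel map on the whole line.\<close>
  define c' where "c' t = (if t \<in> S then c t else undefined)" for t
  have c' [measurable]: "c' \<in> borel_measurable borel"
    unfolding c'_def using S(1) c unfolding S_def
    by (intro borel_measurable_continuous_on_if) (auto intro: continuous_on_const)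
  define \<nu>' where "\<nu>' = distr \<eta> borel c'"
  have "borel_prob \<nu>'"
    unfolding borel_prob_def \<nu>'_def by (auto intro!: \<eta>.prob_space_distr)
  moreover have "(\<lambda>j. \<integral>x. F x \<partial>\<nu> (r j)) \<longlonglongrightarrow> (\<integral>x. F x \<partial>\<nu>')"
    if F: "continuous_on UNIV F" "\<And>x. \<bar>F x\<bar> \<le> B" for F :: "'a \<Rightarrow> real" and B
  proof -
    have [measurable]: "F \<in> borel_measurable borel"
      by (rule borel_measurable_continuous_onI[OF F(1)])
    have Fc: "continuous_on S (\<lambda>t. F (c t))"
      using c unfolding S_def by (intro continuous_on_compose2[OF F(1)]) auto
    have "0 \<le> B" using F(2)[of undefined] by linarith
    obtain G where G: "continuous_on UNIV G" "\<And>t. t \<in> S \<Longrightarrow> G t = F (c t)" "\<And>t. norm (G t) \<le> B"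
      using Tietze[OF Fc _ \<open>0 \<le> B\<close>, of UNIV] S(1) F(2) by (auto simp: closed_closedin[symmetric])
    have [measurable]: "G \<in> borel_measurable borel"
      by (rule borel_measurable_continuous_onI[OF G(1)])
    have "(\<integral>x. F x \<partial>\<nu>') = (\<integral>t. F (c' t) \<partial>\<eta>)"
      unfolding \<nu>'_def by (rule integral_distr) auto
    also have "\<dots> = (\<integral>t. G t \<partial>\<eta>)"
    proof (rule integral_cong_AE)
      show "AE t in \<eta>. F (c' t) = G t"
        using \<open>AE t in \<eta>. t \<in> S\<close> by (auto simp: c'_def G(2))
    qed measurable
    finally have eq: "(\<integral>x. F x \<partial>\<nu>') = (\<integral>t. G t \<partial>\<eta>)" .
    have "G (s x) = F x" for x using G(2)[OF S(3)] cs by simp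
    then show ?thesis using lim[OF G(1), of B] G(3) unfolding eq by simp
  qed
  ultimately show ?thesis using r by blast
qed

section \<open>The random walk\<close>

text \<open>Joint measurability serves Fubini on product spaces; continuity of each
  \<open>act g\<close> serves the Feller property.\<close>

locale continuous_random_walk =
  fixes act :: "'g::metric_space \<Rightarrow> 'x::metric_space \<Rightarrow> 'x" and \<mu> :: "'g measure"
  assumes step_dist: "borel_prob \<mu>"
    and act_measurable: "(\<lambda>p. act (fst p) (snd p)) \<in> borel \<Otimes>\<^sub>M borel \<rightarrow>\<^sub>M borel"
    and act_continuous: "\<And>g. continuous_on UNIV (act g)"
begin

sublocale \<mu>: prob_space \<mu>
  by (rule borel_prob_D(1)[OF step_dist])

lemma sets_step_dist [measurable_cong]: "sets \<mu> = sets borel"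
  by (rule borel_prob_D(2)[OF step_dist])

lemma act_measurable_comp [measurable (raw)]:
  assumes "u \<in> M \<rightarrow>\<^sub>M borel" "v \<in> M \<rightarrow>\<^sub>M borel"
  shows "(\<lambda>w. act (u w) (v w)) \<in> M \<rightarrow>\<^sub>M borel"
  using measurable_compose[OF measurable_Pair[OF assms] act_measurable] by simp

section \<open>Laws of the walk and the Markov property\<close>

lemma walk_pos_measurable:
  "n \<le> k \<Longrightarrow> (\<lambda>w. walk_pos act w n x) \<in> PiM {..<k} (\<lambda>_. \<mu>) \<rightarrow>\<^sub>M borel"
proof (induction n)
  case (Suc n)
  have "(\<lambda>w. w n) \<in> PiM {..<k} (\<lambda>_. \<mu>) \<rightarrow>\<^sub>M \<mu>"
    using Suc.prems by (intro measurable_component_singleton) auto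
  then have "(\<lambda>w. w n) \<in> PiM {..<k} (\<lambda>_. \<mu>) \<rightarrow>\<^sub>M borel"
    using measurable_cong_sets[OF refl sets_step_dist] by blast
  then show ?case using Suc by simp
qed simp

text \<open>The first n steps read only the coordinates below n. Splitting off the last coordinate
  of a product therefore leaves the earlier position unchanged.\<close>

lemma walk_pos_upd: "n \<le> k \<Longrightarrow> walk_pos act (w(k := g)) n x = walk_pos act w n x"
  by (induction n) auto

lemma borel_prob_walk_dist: "borel_prob (walk_dist act \<mu> n x)"
proof -
  interpret P: prob_space "PiM {..<n} (\<lambda>_. \<mu>)"
    by (intro prob_space_PiM \<mu>.prob_space_axioms)
  show ?thesis
    unfolding borel_prob_def walk_dist_def
    using P.prob_space_distr[OF walk_pos_measurable[of n n x]] by simp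
qed

text \<open>Fubini in the last coordinate. The nonnegative form is made for \<open>V\<close>, whose
  expectation is not known to be finite beforehand.\<close>

lemma nn_integral_walk_dist_Suc:
  assumes [measurable]: "F \<in> borel_measurable borel"
  shows "(\<integral>\<^sup>+y. F y \<partial>walk_dist act \<mu> (Suc n) x) = (\<integral>\<^sup>+y. (\<integral>\<^sup>+g. F (act g y) \<partial>\<mu>) \<partial>walk_dist act \<mu> n x)"
proof -
  interpret product_sigma_finite "\<lambda>_::nat. \<mu>" by standard
  note [measurable] = walk_pos_measurable
  have "(\<lambda>w. F (walk_pos act w (Suc n) x)) \<in> borel_measurable (PiM {..<Suc n} (\<lambda>_. \<mu>))"
    by (rule measurable_compose[OF walk_pos_measurable]) auto
  then have "(\<integral>\<^sup>+w. F (walk_pos act w (Suc n) x) \<partial>PiM {..<Suc n} (\<lambda>_. \<mu>))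
      = (\<integral>\<^sup>+w. (\<integral>\<^sup>+g. F (walk_pos act (w(n := g)) (Suc n) x) \<partial>\<mu>) \<partial>PiM {..<n} (\<lambda>_. \<mu>))"
    unfolding lessThan_Suc by (intro product_nn_integral_insert) auto
  also have "\<dots> = (\<integral>\<^sup>+w. (\<integral>\<^sup>+g. F (act g (walk_pos act w n x)) \<partial>\<mu>) \<partial>PiM {..<n} (\<lambda>_. \<mu>))"
    by (simp add: walk_pos_upd)
  finally show ?thesis
    unfolding walk_dist_def
    by (subst (1 2) nn_integral_distr) (auto simp del: walk_pos.simps)
qed

text \<open>The Markov operator of the walk as a real-valued integral, for use on bounded functions;
  \<open>pi_op\<close> is its extended nonnegative version.\<close>

definition step_op :: "('x \<Rightarrow> real) \<Rightarrow> 'x \<Rightarrow> real" where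
  "step_op F y = (\<integral>g. F (act g y) \<partial>\<mu>)"

lemma step_op_measurable [measurable]:
  assumes [measurable]: "F \<in> borel_measurable borel"
  shows "step_op F \<in> borel_measurable borel"
  unfolding step_op_def by measurable

lemma borel_prob_act: "borel_prob (distr \<mu> borel (\<lambda>g. act g y))"
  unfolding borel_prob_def by (auto intro!: \<mu>.prob_space_distr)

lemma step_op_eq_distr:
  "F \<in> borel_measurable borel \<Longrightarrow> step_op F y = (\<integral>z. F z \<partial>distr \<mu> borel (\<lambda>g. act g y))"
  unfolding step_op_def by (rule integral_distr[symmetric]) auto

lemma step_op_bounded:
  assumes "F \<in> borel_measurable borel" "\<And>y. \<bar>F y\<bar> \<le> B"
  shows "\<bar>step_op F y\<bar> \<le> B"
  unfolding step_op_eq_distr[OF assms(1)]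
  by (rule borel_prob_abs_integral_le[OF borel_prob_act assms])

text \<open>Feller property: dominated convergence with the constant \<open>B\<close>, integrable
  because \<mu> is a probability measure.\<close>

lemma step_op_continuous:
  assumes F: "continuous_on UNIV F" "\<And>y. \<bar>F y\<bar> \<le> B"
  shows "continuous_on UNIV (step_op F)"
  unfolding continuous_on_sequentially
proof (intro allI ballI impI, elim conjE)
  fix y :: "nat \<Rightarrow> 'x" and a assume y: "y \<longlonglongrightarrow> a"
  have [measurable]: "F \<in> borel_measurable borel"
    by (rule borel_measurable_continuous_onI[OF F(1)])
  have "(\<lambda>n. \<integral>g. F (act g (y n)) \<partial>\<mu>) \<longlonglongrightarrow> (\<integral>g. F (act g a) \<partial>\<mu>)"
  proof (rule integral_dominated_convergence[where w="\<lambda>_. B"])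
    have "(\<lambda>n. F (act g (y n))) \<longlonglongrightarrow> F (act g a)" for g
      by (intro continuous_on_tendsto_compose[OF F(1)] continuous_on_tendsto_compose[OF act_continuous] y) auto
    then show "AE g in \<mu>. (\<lambda>n. F (act g (y n))) \<longlonglongrightarrow> F (act g a)" by simp
  qed (use F(2) in auto)
  then show "(step_op F \<circ> y) \<longlonglongrightarrow> step_op F a"
    unfolding step_op_def by (simp add: comp_def)
qed

lemma integral_walk_dist_Suc:
  fixes F :: "'x \<Rightarrow> real"
  assumes [measurable]: "F \<in> borel_measurable borel" and F: "\<And>y. \<bar>F y\<bar> \<le> B"
  shows "(\<integral>y. F y \<partial>walk_dist act \<mu> (Suc n) x) = (\<integral>y. step_op F y \<partial>walk_dist act \<mu> n x)"
proof -
  interpret product_sigma_finite "\<lambda>_::nat. \<mu>" by standard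
  note [measurable] = walk_pos_measurable
  interpret P: prob_space "PiM {..<Suc n} (\<lambda>_. \<mu>)"
    by (intro prob_space_PiM \<mu>.prob_space_axioms)
  have "(\<lambda>w. F (walk_pos act w (Suc n) x)) \<in> borel_measurable (PiM {..<Suc n} (\<lambda>_. \<mu>))"
    by (rule measurable_compose[OF walk_pos_measurable]) auto
  then have "integrable (PiM {..<Suc n} (\<lambda>_. \<mu>)) (\<lambda>w. F (walk_pos act w (Suc n) x))"
    using F by (intro P.integrable_const_bound[of _ B]) auto
  then have "(\<integral>w. F (walk_pos act w (Suc n) x) \<partial>PiM {..<Suc n} (\<lambda>_. \<mu>))
      = (\<integral>w. (\<integral>g. F (walk_pos act (w(n := g)) (Suc n) x) \<partial>\<mu>) \<partial>PiM {..<n} (\<lambda>_. \<mu>))"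
    unfolding lessThan_Suc by (intro product_integral_insert) auto
  also have "\<dots> = (\<integral>w. step_op F (walk_pos act w n x) \<partial>PiM {..<n} (\<lambda>_. \<mu>))"
    by (simp add: walk_pos_upd step_op_def)
  finally show ?thesis
    unfolding walk_dist_def
    by (subst (1 2) integral_distr) (auto simp del: walk_pos.simps)
qed

lemma integral_walk_dist_0:
  fixes F :: "'x \<Rightarrow> real"
  assumes [measurable]: "F \<in> borel_measurable borel"
  shows "(\<integral>y. F y \<partial>walk_dist act \<mu> 0 x) = F x"
proof -
  interpret P: prob_space "PiM {..<0::nat} (\<lambda>_. \<mu>)"
    by (intro prob_space_PiM \<mu>.prob_space_axioms)
  show ?thesis
    unfolding walk_dist_def
    by (subst integral_distr[OF walk_pos_measurable[OF order_refl]]) (auto simp: P.prob_space[simplified])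
qed

lemma funpow_step_op:
  assumes "F \<in> borel_measurable borel" "\<And>y. \<bar>F y\<bar> \<le> B"
  shows "(step_op ^^ n) F \<in> borel_measurable borel" "\<And>y. \<bar>(step_op ^^ n) F y\<bar> \<le> B"
proof -
  have "(step_op ^^ n) F \<in> borel_measurable borel \<and> (\<forall>y. \<bar>(step_op ^^ n) F y\<bar> \<le> B)"
    by (induction n) (use assms in \<open>auto intro: step_op_bounded\<close>)
  then show "(step_op ^^ n) F \<in> borel_measurable borel" "\<And>y. \<bar>(step_op ^^ n) F y\<bar> \<le> B" by auto
qed

text \<open>Peeling off the last step replaces \<open>F\<close> by \<open>step_op F\<close> and
  keeps the starting point, so the induction runs over all bounded \<open>F\<close> at once.\<close>

lemma integral_walk_dist:
  fixes F :: "'x \<Rightarrow> real"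
  assumes "F \<in> borel_measurable borel" "\<And>y. \<bar>F y\<bar> \<le> B"
  shows "(\<integral>y. F y \<partial>walk_dist act \<mu> n x) = (step_op ^^ n) F x"
  using assms
proof (induction n arbitrary: F)
  case 0
  then show ?case by (simp add: integral_walk_dist_0)
next
  case (Suc n)
  have "(\<integral>y. F y \<partial>walk_dist act \<mu> (Suc n) x) = (step_op ^^ n) (step_op F) x"
    unfolding integral_walk_dist_Suc[OF Suc.prems]
    by (intro Suc.IH step_op_measurable step_op_bounded Suc.prems)
  then show ?case by (simp add: funpow_swap1)
qed

text \<open>Chapman-Kolmogorov, read off from the law of exponents for powers of
  \<open>step_op\<close>.\<close>

lemma integral_walk_dist_add:
  fixes F :: "'x \<Rightarrow> real"
  assumes "F \<in> borel_measurable borel" "\<And>y. \<bar>F y\<bar> \<le> B"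
  shows "(\<integral>y. F y \<partial>walk_dist act \<mu> (l + k) x)
    = (\<integral>y. (\<integral>z. F z \<partial>walk_dist act \<mu> k y) \<partial>walk_dist act \<mu> l x)"
  by (simp add: integral_walk_dist[OF assms] integral_walk_dist[OF funpow_step_op[OF assms]] funpow_add)

text \<open>The law of the walk at a uniformly random time below n. As a mixture over a
  \<open>pmf\<close> it is a probability measure for every n, including 0, where the distribution of
  the time is unspecified.\<close>

definition cesaro_dist :: "nat \<Rightarrow> 'x \<Rightarrow> 'x measure" where
  "cesaro_dist n x = measure_pmf (pmf_of_set {..<n}) \<bind> (\<lambda>k. walk_dist act \<mu> k x)"

lemma walk_dist_kernel:
  "(\<lambda>k. walk_dist act \<mu> k x) \<in> measure_pmf p \<rightarrow>\<^sub>M subprob_algebra borel"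
  using borel_prob_walk_dist
  by (auto simp: borel_prob_def space_subprob_algebra intro: prob_space_imp_subprob_space)

lemma borel_prob_cesaro_dist: "borel_prob (cesaro_dist n x)"
  unfolding borel_prob_def cesaro_dist_def
proof
  show "prob_space (measure_pmf (pmf_of_set {..<n}) \<bind> (\<lambda>k. walk_dist act \<mu> k x))"
    using borel_prob_walk_dist
    by (intro measure_pmf.prob_space_bind[OF _ walk_dist_kernel]) (auto simp: borel_prob_def)
  show "sets (measure_pmf (pmf_of_set {..<n}) \<bind> (\<lambda>k. walk_dist act \<mu> k x)) = sets borel"
    using borel_prob_walk_dist by (intro sets_bind) (auto simp: borel_prob_def)
qed

lemma integral_cesaro_dist:
  fixes F :: "'x \<Rightarrow> real"
  assumes "F \<in> borel_measurable borel" "\<And>y. \<bar>F y\<bar> \<le> B" "n > 0"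
  shows "(\<integral>y. F y \<partial>cesaro_dist n x) = (\<Sum>k<n. \<integral>y. F y \<partial>walk_dist act \<mu> k x) / n"
proof -
  have "(\<integral>y. F y \<partial>cesaro_dist n x)
      = (\<integral>k. (\<integral>y. F y \<partial>walk_dist act \<mu> k x) \<partial>measure_pmf (pmf_of_set {..<n}))"
    unfolding cesaro_dist_def
  proof (rule integral_bind[OF assms(1) _ walk_dist_kernel, where B=B and B'=1])
    show "AE k in measure_pmf (pmf_of_set {..<n}).
      emeasure (walk_dist act \<mu> k x) (space (walk_dist act \<mu> k x)) \<le> ennreal 1"
      using borel_prob_walk_dist by (simp add: borel_prob_def prob_space.emeasure_space_1)
  qed (use assms measure_pmf.finite_measure_axioms in auto)
  also have "\<dots> = (\<Sum>k<n. \<integral>y. F y \<partial>walk_dist act \<mu> k x) / n"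
    using \<open>n > 0\<close> by (subst integral_pmf_of_set) auto
  finally show ?thesis .
qed

text \<open>The sum telescopes to the terms at times n and 0, each at most \<open>B\<close>. The
  error of order 1/n is what makes weak limits stationary.\<close>

lemma integral_cesaro_dist_step_op:
  assumes F: "F \<in> borel_measurable borel" "\<And>y. \<bar>F y\<bar> \<le> B" and "n > 0"
  shows "\<bar>(\<integral>y. step_op F y \<partial>cesaro_dist n x) - (\<integral>y. F y \<partial>cesaro_dist n x)\<bar> \<le> 2 * B / n"
proof -
  have "(\<integral>y. step_op F y \<partial>cesaro_dist n x) - (\<integral>y. F y \<partial>cesaro_dist n x)
      = (\<Sum>k<n. (step_op ^^ Suc k) F x - (step_op ^^ k) F x) / n"
    by (simp add: integral_cesaro_dist[OF F \<open>n > 0\<close>] integral_walk_dist[OF F]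
      integral_cesaro_dist[OF step_op_measurable[OF F(1)] step_op_bounded[OF F] \<open>n > 0\<close>]
      integral_walk_dist[OF step_op_measurable[OF F(1)] step_op_bounded[OF F]]
      funpow_swap1 sum_subtractf diff_divide_distrib)
  also have "\<dots> = ((step_op ^^ n) F x - F x) / n"
    using sum_lessThan_telescope[of "\<lambda>k. (step_op ^^ k) F x" n] by simp
  finally have "\<bar>(\<integral>y. step_op F y \<partial>cesaro_dist n x) - (\<integral>y. F y \<partial>cesaro_dist n x)\<bar>
      = \<bar>(step_op ^^ n) F x - F x\<bar> / n" by simp
  also have "\<bar>(step_op ^^ n) F x - F x\<bar> \<le> 2 * B"
    using funpow_step_op(2)[OF F, of n x] F(2)[of x] by linarith
  finally show ?thesis by (simp add: divide_right_mono)
qed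

section \<open>Convolution and its duality with the Markov operator\<close>

lemma conv_meas_borel_prob:
  assumes "borel_prob \<nu>"
  shows "borel_prob (conv_meas act \<mu> \<nu>)"
proof -
  interpret \<nu>: prob_space \<nu> by (rule borel_prob_D(1)[OF assms])
  interpret pair_prob_space \<mu> \<nu> by standard
  note [measurable_cong] = borel_prob_D(2)[OF assms]
  show ?thesis
    unfolding borel_prob_def conv_meas_def by (auto intro!: P.prob_space_distr)
qed

text \<open>Fubini; stationarity of \<nu> becomes equality of the integrals of
  \<open>step_op F\<close> and \<open>F\<close> against \<nu>.\<close>

lemma integral_conv_meas:
  assumes \<nu>: "borel_prob \<nu>" and F [measurable]: "F \<in> borel_measurable borel" and B: "\<And>y. \<bar>F y\<bar> \<le> B"
  shows "(\<integral>y. F y \<partial>conv_meas act \<mu> \<nu>) = (\<integral>y. step_op F y \<partial>\<nu>)"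
proof -
  interpret \<nu>: prob_space \<nu> by (rule borel_prob_D(1)[OF \<nu>])
  interpret pair_prob_space \<mu> \<nu> by standard
  note [measurable_cong] = borel_prob_D(2)[OF \<nu>]
  have "(\<integral>y. F y \<partial>conv_meas act \<mu> \<nu>) = (\<integral>p. F (act (fst p) (snd p)) \<partial>(\<mu> \<Otimes>\<^sub>M \<nu>))"
    unfolding conv_meas_def by (rule integral_distr) auto
  also have "\<dots> = (\<integral>(g, y). F (act g y) \<partial>(\<mu> \<Otimes>\<^sub>M \<nu>))"
    by (simp add: case_prod_beta')
  also have "\<dots> = (\<integral>y. step_op F y \<partial>\<nu>)"
    unfolding step_op_def
    by (intro integral_snd[symmetric] P.integrable_const_bound[of _ B]) (use B in auto)
  finally show ?thesis .
qed

end

section \<open>Lyapunov functions and the ergodic averages\<close>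

text \<open>Markov's inequality, phrased with the nonnegative integral because the drift bounds come
  in that form.\<close>

lemma borel_prob_tail_bound:
  fixes V :: "'a::topological_space \<Rightarrow> real"
  assumes L: "borel_prob L" and V: "V \<in> borel_measurable borel" 
    and le: "(\<integral>\<^sup>+y. ennreal (V y) \<partial>L) \<le> ennreal C" and "C \<ge> 0" "R > 0"
  shows "measure L {y. V y > R} \<le> C / R"
proof -
  interpret L: prob_space L by (rule borel_prob_D(1)[OF L])
  have [measurable]: "{y. V y > R} \<in> sets L"
    using V borel_prob_D(2)[OF L] by simp
  have "ennreal (R * measure L {y. V y > R}) = (\<integral>\<^sup>+y. ennreal R * indicator {y. V y > R} y \<partial>L)"
    using \<open>R > 0\<close> by (simp add: nn_integral_cmult L.emeasure_eq_measure ennreal_mult)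
  also have "\<dots> \<le> (\<integral>\<^sup>+y. ennreal (V y) \<partial>L)"
    by (rule nn_integral_mono) (auto simp: indicator_def intro: ennreal_leI)
  also note le
  finally have "R * measure L {y. V y > R} \<le> C"
    using \<open>C \<ge> 0\<close> by (simp add: ennreal_le_iff)
  then show ?thesis using \<open>R > 0\<close> by (simp add: field_simps)
qed

text \<open>The rate \<open>c\<close> is free; it will be set against the exponential decay of the
  powers of \<alpha>.\<close>

lemma subexp_growth_eventually_le:
  assumes "subexp_growth \<phi>" "\<And>n. \<phi> n \<ge> 1" "c > 0"
  shows "eventually (\<lambda>n. \<phi> n \<le> exp (c * real n)) sequentially"
proof -
  have "limsup (\<lambda>n. ereal (ln (\<phi> n) / real n)) < ereal c"
    using assms(1,3) unfolding subexp_growth_def by simp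
  from Limsup_lessD[OF this] have "eventually (\<lambda>n. ln (\<phi> n) / real n < c) sequentially"
    by simp
  then show ?thesis
    using eventually_gt_at_top[of 0]
  proof eventually_elim
    case (elim n)
    then have "ln (\<phi> n) \<le> c * real n" by (simp add: field_simps)
    then have "exp (ln (\<phi> n)) \<le> exp (c * real n)" by simp
    moreover have "\<phi> n > 0" using assms(2)[of n] by linarith
    ultimately show ?case by simp
  qed
qed

text \<open>Positivity of \<alpha> is included so that \<open>ln \<alpha>\<close> and
  \<open>1 / \<alpha>\<close> make sense in the decay estimate.\<close>

locale lyapunov_random_walk = continuous_random_walk act \<mu>
  for act :: "'g::metric_space \<Rightarrow> 'x::metric_space \<Rightarrow> 'x" and \<mu> :: "'g measure" +
  fixes V :: "'x \<Rightarrow> real" and \<alpha> \<beta> :: real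
  assumes V_continuous: "continuous_on UNIV V" and V_nonneg: "\<And>x. V x \<ge> 0"
    and V_proper: "\<And>R. compact {x. V x \<le> R}"
    and \<alpha>: "0 < \<alpha>" "\<alpha> < 1" and \<beta>: "\<beta> \<ge> 0"
    and drift: "\<And>x. pi_op act \<mu> V x \<le> ennreal (\<alpha> * V x + \<beta>)"
begin

lemma V_measurable [measurable]: "V \<in> borel_measurable borel"
  by (rule borel_measurable_continuous_onI[OF V_continuous])

text \<open>\<open>\<beta> / (1 - \<alpha>)\<close> is the fixed point of the map sending t to
  \<alpha> t + \<beta>, so every application of the drift inequality reproduces it and contracts
  only the first term.\<close>

lemma nn_integral_V_walk_dist:
  "(\<integral>\<^sup>+y. ennreal (V y) \<partial>walk_dist act \<mu> n x) \<le> ennreal (\<alpha> ^ n * V x + \<beta> / (1 - \<alpha>))"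
proof (induction n)
  case 0
  interpret P: prob_space "PiM {..<0::nat} (\<lambda>_. \<mu>)"
    by (intro prob_space_PiM \<mu>.prob_space_axioms)
  have "(\<integral>\<^sup>+y. ennreal (V y) \<partial>walk_dist act \<mu> 0 x) = ennreal (V x)"
    unfolding walk_dist_def
    by (subst nn_integral_distr[OF walk_pos_measurable[OF order_refl]])
       (auto simp: P.emeasure_space_1[simplified])
  then show ?case using \<alpha> \<beta> V_nonneg[of x] by (auto intro!: ennreal_leI)
next
  case (Suc n)
  let ?L = "walk_dist act \<mu> n x"
  note [measurable_cong] = borel_prob_D(2)[OF borel_prob_walk_dist]
  interpret L: prob_space ?L by (rule borel_prob_D(1)[OF borel_prob_walk_dist])
  have "(\<integral>\<^sup>+y. ennreal (V y) \<partial>walk_dist act \<mu> (Suc n) x) = (\<integral>\<^sup>+y. pi_op act \<mu> V y \<partial>?L)"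
    unfolding pi_op_def by (rule nn_integral_walk_dist_Suc) measurable
  also have "\<dots> \<le> (\<integral>\<^sup>+y. ennreal \<alpha> * ennreal (V y) + ennreal \<beta> \<partial>?L)"
    using drift \<alpha> \<beta> V_nonneg by (intro nn_integral_mono) (simp add: ennreal_mult[symmetric] ennreal_plus[symmetric] del: ennreal_plus)
  also have "\<dots> = ennreal \<alpha> * (\<integral>\<^sup>+y. ennreal (V y) \<partial>?L) + ennreal \<beta>"
    by (simp add: nn_integral_add nn_integral_cmult L.emeasure_space_1)
  also have "\<dots> \<le> ennreal \<alpha> * ennreal (\<alpha> ^ n * V x + \<beta> / (1 - \<alpha>)) + ennreal \<beta>"
    by (intro add_right_mono mult_left_mono Suc.IH) simp
  also have "\<dots> = ennreal (\<alpha> * (\<alpha> ^ n * V x + \<beta> / (1 - \<alpha>)) + \<beta>)"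
    using \<alpha> \<beta> V_nonneg[of x] by (simp add: ennreal_mult[symmetric] ennreal_plus[symmetric] del: ennreal_plus)
  also have "\<alpha> * (\<alpha> ^ n * V x + \<beta> / (1 - \<alpha>)) + \<beta> = \<alpha> ^ Suc n * V x + \<beta> / (1 - \<alpha>)"
    using \<alpha> by (simp add: field_simps)
  finally show ?case .
qed

text \<open>Powers of \<alpha> are at most 1, so the bound is free of n: one compact sublevel set
  captures most of the mass of all these averages.\<close>

lemma nn_integral_V_cesaro_dist:
  "(\<integral>\<^sup>+y. ennreal (V y) \<partial>cesaro_dist n x) \<le> ennreal (V x + \<beta> / (1 - \<alpha>))"
proof -
  have "(\<integral>\<^sup>+y. ennreal (V y) \<partial>cesaro_dist n x)
      = (\<integral>\<^sup>+k. (\<integral>\<^sup>+y. ennreal (V y) \<partial>walk_dist act \<mu> k x) \<partial>measure_pmf (pmf_of_set {..<n}))"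
    unfolding cesaro_dist_def by (rule nn_integral_bind[OF _ walk_dist_kernel]) measurable
  also have "\<dots> \<le> (\<integral>\<^sup>+k. ennreal (V x + \<beta> / (1 - \<alpha>)) \<partial>measure_pmf (pmf_of_set {..<n}))"
  proof (rule nn_integral_mono)
    fix k
    have "\<alpha> ^ k * V x \<le> 1 * V x"
      using \<alpha> V_nonneg by (intro mult_right_mono power_le_one) auto
    then show "(\<integral>\<^sup>+y. ennreal (V y) \<partial>walk_dist act \<mu> k x) \<le> ennreal (V x + \<beta> / (1 - \<alpha>))"
      by (intro order_trans[OF nn_integral_V_walk_dist] ennreal_leI) simp
  qed
  also have "\<dots> = ennreal (V x + \<beta> / (1 - \<alpha>))"
    by (simp add: measure_pmf.emeasure_space_1)
  finally show ?thesis .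
qed

text \<open>By contradiction: averages that stay \<epsilon> away, with starting points moving inside
  the sublevel set, are still tight, since tightness depends on the start only through
  \<open>V\<close>. A weak limit would have to be \<open>m\<close>.\<close>

lemma uniform_convergence_on_sublevel:
  fixes U :: "nat \<Rightarrow> 'x set" and F :: "'x \<Rightarrow> real"
  assumes U: "topological_basis (range U)"
    and ue: "uniquely_ergodic act \<mu> m"
    and F: "continuous_on UNIV F" "\<And>y. \<bar>F y\<bar> \<le> B"
    and "\<epsilon> > 0"
  shows "\<exists>N. \<forall>n\<ge>N. \<forall>x. V x \<le> R \<longrightarrow>
    \<bar>(\<Sum>k<n. \<integral>y. F y \<partial>walk_dist act \<mu> k x) / n - (\<integral>y. F y \<partial>m)\<bar> \<le> \<epsilon>"
proof (rule ccontr)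
  assume "\<not> ?thesis"
  \<comment> \<open>\<open>Suc j\<close> makes the times both positive and unbounded.\<close>
  then have "\<forall>j. \<exists>n x. n \<ge> Suc j \<and> V x \<le> R \<and>
    \<bar>(\<Sum>k<n. \<integral>y. F y \<partial>walk_dist act \<mu> k x) / n - (\<integral>y. F y \<partial>m)\<bar> > \<epsilon>"
    by (auto simp: not_le)
  then obtain n x where n: "\<And>j. n j \<ge> Suc j" and x: "\<And>j. V (x j) \<le> R"
    and far: "\<And>j. \<bar>(\<Sum>k<n j. \<integral>y. F y \<partial>walk_dist act \<mu> k (x j)) / n j - (\<integral>y. F y \<partial>m)\<bar> > \<epsilon>"
    by metis
  have n_pos: "n j > 0" for j using n[of j] by simp
  define \<nu> where "\<nu> j = cesaro_dist (n j) (x j)" for j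
  have \<nu>: "borel_prob (\<nu> j)" for j
    unfolding \<nu>_def by (rule borel_prob_cesaro_dist)
  define C where "C = max 0 R + \<beta> / (1 - \<alpha>)"
  have "C \<ge> 0" unfolding C_def using \<alpha> \<beta> by simp
  have V_\<nu>: "(\<integral>\<^sup>+y. ennreal (V y) \<partial>\<nu> j) \<le> ennreal C" for j
    unfolding \<nu>_def C_def using x[of j]
    by (intro order_trans[OF nn_integral_V_cesaro_dist] ennreal_leI) auto
  have tight: "\<exists>R'. \<forall>j. measure (\<nu> j) {y. V y \<le> R'} > 1 - \<delta>" if "\<delta> > 0" for \<delta>
  proof -
    \<comment> \<open>With \<open>C + 1\<close> in place of \<open>C\<close>, the tail bound
      \<open>C / R'\<close> is strictly below \<delta>, also when \<open>C\<close> is 0.\<close>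
    define R' where "R' = (C + 1) / \<delta>"
    have "R' > 0" unfolding R'_def using \<open>C \<ge> 0\<close> \<open>\<delta> > 0\<close> by simp
    have "measure (\<nu> j) {y. V y \<le> R'} > 1 - \<delta>" for j
    proof -
      interpret prob_space "\<nu> j" by (rule borel_prob_D(1)[OF \<nu>])
      have "{y. V y \<le> R'} \<in> sets (\<nu> j)" using borel_prob_D(2)[OF \<nu>[of j]] by simp
      moreover have "space (\<nu> j) - {y. V y \<le> R'} = {y. V y > R'}"
        using borel_prob_D(3)[OF \<nu>[of j]] by auto
      ultimately have "measure (\<nu> j) {y. V y \<le> R'} = 1 - measure (\<nu> j) {y. V y > R'}"
        using prob_compl[of "{y. V y \<le> R'}"] by simp
      moreover have "measure (\<nu> j) {y. V y > R'} \<le> C / R'"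
        by (rule borel_prob_tail_bound[OF \<nu> V_measurable V_\<nu> \<open>C \<ge> 0\<close> \<open>R' > 0\<close>])
      moreover have "C / R' < \<delta>"
        unfolding R'_def using \<open>C \<ge> 0\<close> \<open>\<delta> > 0\<close> by (simp add: field_simps)
      ultimately show ?thesis by linarith
    qed
    then show ?thesis by blast
  qed
  obtain r \<nu>' where r: "strict_mono (r :: nat \<Rightarrow> nat)" and \<nu>': "borel_prob \<nu>'"
    and lim: "\<And>G B. continuous_on UNIV G \<Longrightarrow> (\<And>y. \<bar>G y :: real\<bar> \<le> B) \<Longrightarrow>
       (\<lambda>j. \<integral>y. G y \<partial>\<nu> (r j)) \<longlonglongrightarrow> (\<integral>y. G y \<partial>\<nu>')"
    using tight_sequence_convergent_subsequence[OF U V_continuous V_nonneg V_proper \<nu> tight] by blast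
  have "conv_meas act \<mu> \<nu>' = \<nu>'"
  proof (rule borel_prob_eqI[OF conv_meas_borel_prob[OF \<nu>'] \<nu>'])
    fix G :: "'x \<Rightarrow> real" assume G: "continuous_on UNIV G" "\<And>y. \<bar>G y\<bar> \<le> 1"
    have G_meas: "G \<in> borel_measurable borel"
      by (rule borel_measurable_continuous_onI[OF G(1)])
    have "(\<lambda>j. (\<integral>y. step_op G y \<partial>\<nu> (r j)) - (\<integral>y. G y \<partial>\<nu> (r j)))
        \<longlonglongrightarrow> (\<integral>y. step_op G y \<partial>\<nu>') - (\<integral>y. G y \<partial>\<nu>')"
      by (intro tendsto_diff lim[OF G] lim[OF step_op_continuous[OF G] step_op_bounded[OF G_meas G(2)]])
    moreover have "(\<lambda>j. (\<integral>y. step_op G y \<partial>\<nu> (r j)) - (\<integral>y. G y \<partial>\<nu> (r j))) \<longlonglongrightarrow> 0"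
    proof (rule Lim_null_comparison)
      have "norm ((\<integral>y. step_op G y \<partial>\<nu> (r j)) - (\<integral>y. G y \<partial>\<nu> (r j))) \<le> 2 * inverse (real (Suc j))" for j
      proof -
        have "norm ((\<integral>y. step_op G y \<partial>\<nu> (r j)) - (\<integral>y. G y \<partial>\<nu> (r j))) \<le> 2 * 1 / n (r j)"
          unfolding \<nu>_def real_norm_def
          by (rule integral_cesaro_dist_step_op[OF G_meas G(2) n_pos])
        \<comment> \<open>A strictly increasing \<open>r\<close> has \<open>r j \<ge> j\<close>,
          hence \<open>n (r j) \<ge> Suc j\<close>.\<close>
        also have "\<dots> \<le> 2 * inverse (real (Suc j))"
          using n[of "r j"] seq_suble[OF r, of j] by (simp add: divide_simps)
        finally show ?thesis .
      qed
      then show "eventually (\<lambda>j. norm ((\<integral>y. step_op G y \<partial>\<nu> (r j)) - (\<integral>y. G y \<partial>\<nu> (r j)))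
        \<le> 2 * inverse (real (Suc j))) sequentially" by simp
      show "(\<lambda>j. 2 * inverse (real (Suc j))) \<longlonglongrightarrow> 0"
        using tendsto_mult_right_zero[OF LIMSEQ_inverse_real_of_nat] .
    qed
    ultimately have "(\<integral>y. step_op G y \<partial>\<nu>') - (\<integral>y. G y \<partial>\<nu>') = 0"
      by (rule LIMSEQ_unique)
    then show "(\<integral>y. G y \<partial>conv_meas act \<mu> \<nu>') = (\<integral>y. G y \<partial>\<nu>')"
      by (simp add: integral_conv_meas[OF \<nu>' G_meas G(2)])
  qed
  then have "\<nu>' = m" using ue \<nu>' unfolding uniquely_ergodic_def stationary_def by blast
  then have "(\<lambda>j. \<integral>y. F y \<partial>\<nu> (r j)) \<longlonglongrightarrow> (\<integral>y. F y \<partial>m)"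
    using lim[OF F] by simp
  then obtain j where "\<bar>(\<integral>y. F y \<partial>\<nu> (r j)) - (\<integral>y. F y \<partial>m)\<bar> < \<epsilon>"
    using LIMSEQ_D[OF _ \<open>\<epsilon> > 0\<close>] by fastforce
  moreover have "(\<integral>y. F y \<partial>\<nu> (r j)) = (\<Sum>k<n (r j). \<integral>y. F y \<partial>walk_dist act \<mu> k (x (r j))) / n (r j)"
    unfolding \<nu>_def
    by (rule integral_cesaro_dist[OF borel_measurable_continuous_onI[OF F(1)] F(2) n_pos])
  ultimately show False using far[of "r j"] by simp
qed

text \<open>Markov property at time \<open>l\<close>: time \<open>l + k\<close> is time
  \<open>k\<close> of a walk restarted at the random position reached after \<open>l\<close>
  steps.\<close>

lemma ergodic_sum_split:
  assumes F: "F \<in> borel_measurable borel" "\<And>y. \<bar>F y :: real\<bar> \<le> B"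
  shows "(\<Sum>k<l + p. \<integral>y. F y \<partial>walk_dist act \<mu> k x) = (\<Sum>k<l. \<integral>y. F y \<partial>walk_dist act \<mu> k x)
    + (\<integral>y. (\<Sum>k<p. \<integral>z. F z \<partial>walk_dist act \<mu> k y) \<partial>walk_dist act \<mu> l x)"
proof -
  have "integrable (walk_dist act \<mu> l x) (\<lambda>y. \<integral>z. F z \<partial>walk_dist act \<mu> k y)" for k
    using borel_prob_integrable_bounded[OF borel_prob_walk_dist funpow_step_op[OF F]]
    by (simp add: integral_walk_dist[OF F])
  then have "(\<integral>y. (\<Sum>k<p. \<integral>z. F z \<partial>walk_dist act \<mu> k y) \<partial>walk_dist act \<mu> l x)
      = (\<Sum>k<p. \<integral>y. F y \<partial>walk_dist act \<mu> (l + k) x)"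
    by (simp add: integral_walk_dist_add[OF F])
  moreover have "(\<Sum>k<l + p. \<integral>y. F y \<partial>walk_dist act \<mu> k x) = (\<Sum>k<l. \<integral>y. F y \<partial>walk_dist act \<mu> k x)
      + (\<Sum>k<p. \<integral>y. F y \<partial>walk_dist act \<mu> (l + k) x)"
    by (induction p) (auto simp: add.assoc)
  ultimately show ?thesis by simp
qed

text \<open>The first \<open>l\<close> steps are discarded; after them the walk lies in \<open>V \<le> R\<close> with high
  probability, where the remaining average is controlled uniformly.\<close>

lemma ergodic_sum_bound:
  fixes \<delta> :: real
  assumes F: "F \<in> borel_measurable borel" "\<And>y. \<bar>F y :: real\<bar> \<le> B"
    and unif: "\<And>y. V y \<le> R \<Longrightarrow> \<bar>\<Sum>k<p. \<integral>z. F z \<partial>walk_dist act \<mu> k y\<bar> \<le> \<delta> * p"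
    and C: "\<alpha> ^ l * V x + \<beta> / (1 - \<alpha>) \<le> C" and "R > 0" "\<delta> \<ge> 0"
  shows "\<bar>\<Sum>k<l + p. \<integral>y. F y \<partial>walk_dist act \<mu> k x\<bar> \<le> B * l + p * (\<delta> + B * (C / R))"
proof -
  let ?L = "walk_dist act \<mu> l x"
  let ?S = "\<lambda>p y. \<Sum>k<p. \<integral>z. F z \<partial>walk_dist act \<mu> k y"
  interpret L: prob_space ?L by (rule borel_prob_D(1)[OF borel_prob_walk_dist])
  note [measurable_cong] = borel_prob_D(2)[OF borel_prob_walk_dist]
  have S_le: "\<bar>?S p y\<bar> \<le> B * p" for p y
  proof -
    have "\<bar>?S p y\<bar> \<le> (\<Sum>k<p. B)"
      by (intro order_trans[OF sum_abs] sum_mono borel_prob_abs_integral_le[OF borel_prob_walk_dist F])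
    then show ?thesis by (simp add: mult.commute)
  qed
  have S_meas: "?S p \<in> borel_measurable borel" for p
    using funpow_step_op(1)[OF F] by (simp add: integral_walk_dist[OF F])
  have "B \<ge> 0" using F(2)[of x] by linarith
  have "C \<ge> 0"
  proof -
    have "0 \<le> \<alpha> ^ l * V x + \<beta> / (1 - \<alpha>)" using \<alpha> \<beta> V_nonneg[of x] by simp
    then show ?thesis using C by linarith
  qed
  have "\<bar>\<integral>y. ?S p y \<partial>?L\<bar> \<le> (\<integral>y. \<bar>?S p y\<bar> \<partial>?L)" by (rule integral_abs_bound)
  also have "\<dots> \<le> (\<integral>y. \<delta> * p + B * p * indicat_real {y. V y > R} y \<partial>?L)"
  proof (rule integral_mono)
    show "integrable ?L (\<lambda>y. \<bar>?S p y\<bar>)"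
      by (intro integrable_abs borel_prob_integrable_bounded[OF borel_prob_walk_dist S_meas S_le])
    show "integrable ?L (\<lambda>y. \<delta> * p + B * p * indicat_real {y. V y > R} y)"
      by (rule L.integrable_const_bound[of _ "\<delta> * p + B * p"])
         (use \<open>\<delta> \<ge> 0\<close> \<open>B \<ge> 0\<close> in \<open>auto simp: indicator_def\<close>)
    show "\<bar>?S p y\<bar> \<le> \<delta> * p + B * p * indicat_real {y. V y > R} y" for y
    proof (cases "V y \<le> R")
      case True
      then show ?thesis using unif[of y] by simp
    next
      case False
      moreover have "0 \<le> \<delta> * p" using \<open>\<delta> \<ge> 0\<close> by simp
      ultimately show ?thesis using S_le[of y p] by simp
    qed
  qed
  also have "\<dots> = \<delta> * p + B * p * measure ?L {y. V y > R}"
  proof -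
    have "{y. V y > R} \<in> sets ?L" by simp
    moreover have "{y. V y > R} \<inter> space ?L = {y. V y > R}"
      using borel_prob_D(3)[OF borel_prob_walk_dist] by auto
    ultimately have "integrable ?L (indicat_real {y. V y > R})"
      and "(\<integral>y. indicat_real {y. V y > R} y \<partial>?L) = measure ?L {y. V y > R}"
      by (simp_all add: L.emeasure_eq_measure)
    then show ?thesis by (simp add: L.prob_space)
  qed
  \<comment> \<open>The drift bound after \<open>l\<close> steps enters here, through Markov's
    inequality for the law of the restart point.\<close>
  also have "\<dots> \<le> \<delta> * p + B * p * (C / R)"
    using \<open>B \<ge> 0\<close> \<open>C \<ge> 0\<close> \<open>R > 0\<close>
    by (intro add_left_mono mult_left_mono
        borel_prob_tail_bound[OF borel_prob_walk_dist V_measurable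
          order_trans[OF nn_integral_V_walk_dist ennreal_leI[OF C]]]) auto
  finally have "\<bar>\<integral>y. ?S p y \<partial>?L\<bar> \<le> p * (\<delta> + B * (C / R))"
    by (simp add: algebra_simps)
  then show ?thesis
    unfolding ergodic_sum_split[OF F] using S_le[of x l] by linarith
qed

text \<open>The error is split into thirds: discarded steps, uniform convergence from restart points
  in the sublevel set, and restart points outside it.\<close>

lemma eventually_average_le:
  fixes U :: "nat \<Rightarrow> 'x set"
  assumes U: "topological_basis (range U)"
    and ue: "uniquely_ergodic act \<mu> m" and m: "borel_prob m"
    and \<phi>: "subexp_growth \<phi>" "\<And>n. \<phi> n \<ge> 1"
    and f: "continuous_on UNIV f" "\<And>y. \<bar>f y :: real\<bar> \<le> B'"
    and "\<epsilon> > 0"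
  shows "eventually (\<lambda>n. \<forall>x. V x \<le> \<phi> n \<longrightarrow>
    \<bar>(1 / real n) * (\<Sum>k<n. \<integral>y. f y \<partial>walk_dist act \<mu> k x) - (\<integral>y. f y \<partial>m)\<bar> \<le> \<epsilon>) sequentially"
proof -
  \<comment> \<open>Centring gives \<open>F\<close> mean zero under \<open>m\<close>, so plain sums
    of \<open>F\<close> have to be small. The summand 1 in \<open>B\<close> keeps \<open>B\<close>,
    and with it \<open>R\<close>, positive.\<close>
  define c where "c = (\<integral>y. f y \<partial>m)"
  define F where "F y = f y - c" for y
  define B where "B = \<bar>B'\<bar> + \<bar>c\<bar> + 1"
  have F: "continuous_on UNIV F" "\<And>y. \<bar>F y\<bar> \<le> B"
  proof -
    show "continuous_on UNIV F" unfolding F_def by (intro continuous_intros f)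
    show "\<bar>F y\<bar> \<le> B" for y unfolding F_def B_def using f(2)[of y] by linarith
  qed
  have F_meas: "F \<in> borel_measurable borel" by (rule borel_measurable_continuous_onI[OF F(1)])
  have f_int: "integrable L f" if "borel_prob L" for L
    by (rule borel_prob_integrable_bounded[OF that borel_measurable_continuous_onI[OF f(1)] f(2)])
  have F_int: "(\<integral>y. F y \<partial>L) = (\<integral>y. f y \<partial>L) - c" if "borel_prob L" for L
    unfolding F_def using f_int[OF that] borel_prob_D(1)[OF that]
    by (simp add: prob_space.prob_space prob_space.finite_measure finite_measure.integrable_const)
  have "B > 0" unfolding B_def by linarith
  \<comment> \<open>The quotient pays for the first third of the error. The 2 ensures that at most
    half of the steps are discarded, so \<open>p \<ge> N\<close> as soon as
    \<open>n \<ge> 2 * N\<close>.\<close>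
  define D :: nat where "D = nat \<lceil>3 * B / \<epsilon>\<rceil> + 2"
  have D: "D \<ge> 2" "B / D \<le> \<epsilon> / 3"
  proof -
    have "3 * B / \<epsilon> \<le> real D" unfolding D_def by linarith
    moreover show "D \<ge> 2" unfolding D_def by simp
    ultimately show "B / D \<le> \<epsilon> / 3" using \<open>\<epsilon> > 0\<close> by (simp add: field_simps)
  qed
  \<comment> \<open>Rounding \<open>n / D\<close> down to \<open>l\<close> loses at most one power
    of \<alpha>, which leaves \<open>1 / \<alpha>\<close> as the bound for
    \<open>\<alpha> ^ l * V x\<close>.\<close>
  define C where "C = 1 / \<alpha> + \<beta> / (1 - \<alpha>)"
  have "C > 0" unfolding C_def using \<alpha> \<beta> by (simp add: add_pos_nonneg)
  define R where "R = 3 * B * C / \<epsilon>"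
  have R: "R > 0" "B * (C / R) = \<epsilon> / 3"
    unfolding R_def using \<open>B > 0\<close> \<open>C > 0\<close> \<open>\<epsilon> > 0\<close> by simp_all
  obtain N where N: "\<And>n x. n \<ge> N \<Longrightarrow> V x \<le> R \<Longrightarrow>
      \<bar>(\<Sum>k<n. \<integral>y. F y \<partial>walk_dist act \<mu> k x) / n - (\<integral>y. F y \<partial>m)\<bar> \<le> \<epsilon> / 3"
    using uniform_convergence_on_sublevel[OF U ue F, of "\<epsilon> / 3" R] \<open>\<epsilon> > 0\<close> by auto
  have m0: "(\<integral>y. F y \<partial>m) = 0" using F_int[OF m] by (simp add: c_def)
  \<comment> \<open>At this growth rate the bound on \<open>\<phi> n\<close> is exactly cancelled by
    n / D powers of \<alpha>.\<close>
  have "- ln \<alpha> / D > 0" using \<alpha> D(1) by (intro divide_pos_pos) auto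
  from subexp_growth_eventually_le[OF \<phi> this] eventually_ge_at_top[of "max 1 (2 * N)"]
  show ?thesis
  proof eventually_elim
    case (elim n)
    define l where "l = n div D"
    define p where "p = n - l"
    have "l \<le> n div 2" unfolding l_def using D(1) by (intro div_le_mono2) auto
    then have lp: "n = l + p" "p \<ge> N" unfolding p_def using elim(2) by auto
    have "n > 0" using elim(2) by simp
    have "real n < real D * (real l + 1)"
    proof -
      have "n < D * (l + 1)" unfolding l_def using D(1) dividend_less_times_div[of D n] by simp
      then show ?thesis by (metis of_nat_1 of_nat_add of_nat_less_iff of_nat_mult)
    qed
    then have l_ge: "real n / D - 1 \<le> l" using D(1) by (simp add: field_simps)
    have "real l * real D \<le> real n"
      unfolding l_def by (metis div_times_less_eq_dividend of_nat_le_iff of_nat_mult)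
    then have l_le: "real l \<le> real n / D" using D(1) by (simp add: field_simps)
    show ?case
    proof (intro allI impI)
      fix x assume x: "V x \<le> \<phi> n"
      have "\<alpha> ^ l * V x \<le> \<alpha> ^ l * exp (- ln \<alpha> / D * n)"
        using x elim(1) \<alpha> by (intro mult_left_mono) auto
      also have "\<dots> = exp ((real n / D - l) * (- ln \<alpha>))"
      proof -
        have "\<alpha> ^ l = exp (real l * ln \<alpha>)" using \<alpha> by (simp add: exp_of_nat_mult)
        moreover have "real l * ln \<alpha> + (- ln \<alpha> / D * n) = (real n / D - l) * (- ln \<alpha>)"
          by (simp add: algebra_simps)
        ultimately show ?thesis by (simp only: exp_add[symmetric])
      qed
      also have "\<dots> \<le> exp (1 * (- ln \<alpha>))"
        unfolding exp_le_cancel_iff using \<alpha> l_ge by (intro mult_right_mono) auto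
      also have "\<dots> = 1 / \<alpha>" using \<alpha> by (simp add: exp_minus inverse_eq_divide)
      finally have C: "\<alpha> ^ l * V x + \<beta> / (1 - \<alpha>) \<le> C" unfolding C_def by simp
      have unif: "\<bar>\<Sum>k<p. \<integral>z. F z \<partial>walk_dist act \<mu> k y\<bar> \<le> \<epsilon> / 3 * p" if "V y \<le> R" for y
        using N[OF lp(2) that] unfolding m0 by (cases "p = 0") (auto simp: field_simps abs_mult)
      have "\<bar>\<Sum>k<n. \<integral>y. F y \<partial>walk_dist act \<mu> k x\<bar> \<le> B * l + p * (\<epsilon> / 3 + B * (C / R))"
        using ergodic_sum_bound[OF F_meas F(2) unif C R(1)] \<open>\<epsilon> > 0\<close> unfolding lp(1) by simp
      also have "\<dots> \<le> B * (n / D) + n * (\<epsilon> / 3 + \<epsilon> / 3)"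
        unfolding R(2) using \<open>B > 0\<close> \<open>\<epsilon> > 0\<close> l_le lp(1)
        by (intro add_mono mult_left_mono mult_right_mono) auto
      also have "\<dots> = n * (B / D + (\<epsilon> / 3 + \<epsilon> / 3))" by (simp add: algebra_simps)
      also have "\<dots> \<le> n * \<epsilon>" using D(2) by (intro mult_left_mono) linarith+
      finally have "\<bar>\<Sum>k<n. \<integral>y. F y \<partial>walk_dist act \<mu> k x\<bar> / n \<le> \<epsilon>"
        using \<open>n > 0\<close> by (simp add: field_simps)
      moreover have "(1 / real n) * (\<Sum>k<n. \<integral>y. f y \<partial>walk_dist act \<mu> k x) - c
          = (\<Sum>k<n. \<integral>y. F y \<partial>walk_dist act \<mu> k x) / n"
        using \<open>n > 0\<close> by (simp add: F_int[OF borel_prob_walk_dist] sum_subtractf field_simps)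
      ultimately show "\<bar>(1 / real n) * (\<Sum>k<n. \<integral>y. f y \<partial>walk_dist act \<mu> k x) - (\<integral>y. f y \<partial>m)\<bar> \<le> \<epsilon>"
        unfolding c_def[symmetric] by simp
    qed
  qed
qed

end

section \<open>Compactly supported test functions and the conclusion\<close>

lemma Cc_bounded:
  fixes f :: "'x::metric_space \<Rightarrow> real"
  assumes "f \<in> Cc"
  obtains B where "\<And>x. \<bar>f x\<bar> \<le> B"
proof -
  let ?S = "closure {x. f x \<noteq> 0}"
  have "compact (f ` ?S)"
    using assms unfolding Cc_def
    by (intro compact_continuous_image) (auto intro: continuous_on_subset)
  then have "\<exists>B. \<forall>x\<in>?S. \<bar>f x\<bar> \<le> B"
    by (auto dest!: compact_imp_bounded simp: bounded_iff)
  then obtain B where B: "\<And>x. x \<in> ?S \<Longrightarrow> \<bar>f x\<bar> \<le> B" by blast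
  have "\<bar>f x\<bar> \<le> max B 0" for x
  proof (cases "f x = 0")
    case False
    then have "x \<in> ?S" using closure_subset by fastforce
    then show ?thesis using B by fastforce
  qed simp
  then show ?thesis by (rule that)
qed

theorem theorem4p13:
  fixes mul :: "'g::metric_space \<Rightarrow> 'g \<Rightarrow> 'g" and ginv :: "'g \<Rightarrow> 'g" and e :: 'g
    and act :: "'g \<Rightarrow> 'x::metric_space \<Rightarrow> 'x"
    and \<mu> :: "'g measure" and m :: "'x measure"
    and V :: "'x \<Rightarrow> real" and \<phi> :: "nat \<Rightarrow> real" and f :: "'x \<Rightarrow> real"
  assumes "lcsc_space TYPE('g)" and "lcsc_space TYPE('x)"
    and "topological_group_ops mul ginv e"
    and "continuous_action mul e act"
    and "borel_prob m" and "invariant_measure act m" and "ergodic_action act m"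
    and "borel_prob \<mu>"
    and "uniquely_ergodic act \<mu> m"
    and "loc_unif_recurrent_avg act \<mu>"
    and "lyapunov act \<mu> V"
    and "\<forall>n. \<phi> n \<ge> 1" and "subexp_growth \<phi>"
    and "f \<in> Cc"
  shows "(\<lambda>n. SUP x\<in>{x. V x \<le> \<phi> n}.
            ennreal \<bar>(1 / real n) * (\<Sum>k<n. \<integral>y. f y \<partial>(walk_dist act \<mu> k x))
                     - (\<integral>y. f y \<partial>m)\<bar>) \<longlonglongrightarrow> 0"
proof -
  obtain T :: "nat \<Rightarrow> 'g set" where T: "topological_basis (range T)"
    using lcsc_space_countable_basis[OF assms(1)] by blast
  obtain U :: "nat \<Rightarrow> 'x set" where U: "topological_basis (range U)"
    using lcsc_space_countable_basis[OF assms(2)] by blast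
  have act: "continuous_on UNIV (\<lambda>p. act (fst p) (snd p))"
    using assms(4) unfolding continuous_action_def by blast
  have V: "continuous_on UNIV V" "\<And>x. V x \<ge> 0" "\<And>K. compact K \<Longrightarrow> compact (V -` K)"
    using assms(11) unfolding lyapunov_def by auto
  obtain a \<beta> where a: "a < 1" and \<beta>: "\<beta> \<ge> 0" and drift: "\<And>x. pi_op act \<mu> V x \<le> ennreal (a * V x + \<beta>)"
    using assms(11) unfolding lyapunov_def by blast
  \<comment> \<open>The given constant may be zero or negative. Since \<open>V\<close> is
    nonnegative, raising it keeps the drift inequality, and 1/2 stays below 1.\<close>
  define \<alpha> where "\<alpha> = max a (1 / 2)"
  interpret lyapunov_random_walk act \<mu> V \<alpha> \<beta>
  proof
    show "borel_prob \<mu>" by (rule assms(8))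
    show "(\<lambda>p. act (fst p) (snd p)) \<in> borel \<Otimes>\<^sub>M borel \<rightarrow>\<^sub>M borel"
      by (rule continuous_on_prod_measurable[OF T U act])
    show "continuous_on UNIV (act g)" for g
      using continuous_on_compose2[OF act, of UNIV "\<lambda>x. (g, x)"] by (simp add: continuous_on_Pair)
    show "compact {x. V x \<le> R}" for R
    proof -
      \<comment> \<open>Properness speaks of preimages of compact sets; nonnegativity of
        \<open>V\<close> replaces the unbounded half-line by \<open>{0..R}\<close>.\<close>
      have "{x. V x \<le> R} = V -` {0..R}" using V(2) by auto
      then show ?thesis using V(3)[of "{0..R}"] by simp
    qed
    show "pi_op act \<mu> V x \<le> ennreal (\<alpha> * V x + \<beta>)" for x
      using V(2)[of x] unfolding \<alpha>_def
      by (intro order_trans[OF drift] ennreal_leI add_right_mono mult_right_mono) auto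
  qed (use V a \<beta> in \<open>auto simp: \<alpha>_def\<close>)
  obtain B where B: "\<And>x. \<bar>f x\<bar> \<le> B" using Cc_bounded[OF assms(14)] by blast
  have f: "continuous_on UNIV f" using assms(14) unfolding Cc_def by blast
  show ?thesis
  proof (rule order_tendstoI)
    fix b :: ennreal assume "0 < b"
    \<comment> \<open>A supremum of terms bounded by \<epsilon> is only known to be at most
      \<epsilon>; the intermediate value restores strictness and is finite even if \<open>b\<close>
      is infinite.\<close>
    then obtain b' where b': "0 < b'" "b' < b" using dense by blast
    then obtain \<epsilon> where \<epsilon>: "b' = ennreal \<epsilon>" "\<epsilon> > 0" by (cases b') auto
    have "eventually (\<lambda>n. \<forall>x. V x \<le> \<phi> n \<longrightarrow>
      \<bar>(1 / real n) * (\<Sum>k<n. \<integral>y. f y \<partial>walk_dist act \<mu> k x) - (\<integral>y. f y \<partial>m)\<bar> \<le> \<epsilon>) sequentially"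
      using assms(12) by (intro eventually_average_le[OF U assms(9,5,13) _ f B \<epsilon>(2)]) blast
    then show "eventually (\<lambda>n. (SUP x\<in>{x. V x \<le> \<phi> n}.
            ennreal \<bar>(1 / real n) * (\<Sum>k<n. \<integral>y. f y \<partial>(walk_dist act \<mu> k x))
                     - (\<integral>y. f y \<partial>m)\<bar>) < b) sequentially"
    proof eventually_elim
      case (elim n)
      then have "(SUP x\<in>{x. V x \<le> \<phi> n}.
            ennreal \<bar>(1 / real n) * (\<Sum>k<n. \<integral>y. f y \<partial>(walk_dist act \<mu> k x))
                     - (\<integral>y. f y \<partial>m)\<bar>) \<le> b'"
        unfolding \<epsilon>(1) by (intro SUP_least ennreal_leI) auto
      then show ?case using b'(2) by (rule le_less_trans)
    qed
  qed simp
qed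

end
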